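(* (1) For all $x_1\ge x_2\ge0$ and all $0\le w\le s\le T$, $V(s,x_1,w)-V(s,x_2,w)\ge x_1-x_2$. (2) For any compact set $\mathfrak D\subset D$, the mapping $x\mapsto V(s,x,w)$ is continuous, uniformly for $(s,x,w)\in\mathfrak D$; i.e. for every $\varepsilon>0$ there is $\delta>0$ such that $|V(s,x,w)-V(s,x',w)|<\varepsilon$ whenever $(s,x,w),(s,x',w)\in\mathfrak D$ and $|x-x'|<\delta$.
   Context: Model. Fix $T>0$ and constants $p>0$ (premium rate), $c>0$ (discount factor). On a probability space $(\Omega,\mathscr F,\mathbb P)$, let $N=(N_t)_{t\ge0}$ be a renewal counting process with jump times $\sigma_n$ ($\sigma_0=0$) and i.i.d. waiting times $T_i=\sigma_i-\sigma_{i-1}$ with distribution function $F$ on $[0,\infty)$ and density $f$; put $\bar F=1-F$. Let $(U_i)_{i\ge1}$ (claim sizes) be i.i.d., independent of $N$, with distribution function $G$ on $[0,\infty)$. Standing assumption: $F$ and $G$ are continuous on $[0,\infty)$; there is a continuous bounded function $\lambda:[0,\infty)\to[0,\infty)$ with $\bar F(t)=\exp(-\int_0^t\lambda(u)du)$, $\lambda(t)=f(t)/\bar F(t)>0$ for $t\in[0,T]$; and there is $\Lambda>0$ with $\lambda(w)\le\Lambda$ for $w\in[0,T]$. Put $Q_t=\sum_{i=1}^{N_t}U_i$, $W_t=t-\sigma_{N_t}$, and let $(\mathscr F_t)$ be the $\mathbb P$-augmented filtration generated by $N,Q,W$. For $s\in[0,T]$, $w\in[0,s]$, let $\mathbb P_{sw}=\mathbb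 P[\,\cdot\,|W_s=w]$ (regular conditional probability) and $N^{s,w}_t=N_t-N_s$ for $t\in[s,T]$; under $\mathbb P_{sw}$ this is a delayed renewal process: the first claim after $s$ occurs at time $s+T_1^{s,w}$, where $\mathbb P_{sw}\{T_1^{s,w}>t\}=\exp(-\int_w^{w+t}\lambda(u)du)$, and later waiting times are independent with law $F$. Put $Q^{s,w}_t=\sum_{i=1}^{N^{s,w}_t}U_i$ and $W^{s,w}_t=w+W_t-W_s$. Strategies and value function. Given $(s,x,w)$ with $x\ge0$, a dividend strategy $\pi=(L_t)$ gives the cumulative dividends $L_t=L_t^\pi$ paid from time $s$ to time $t$ ($L_s=0$; $L_{t+}$ includes a lump sum paid at time $t$, also for $t=T$). The wealth is $X^\pi_t=x+p(t-s)-Q^{s,w}_t-L_t$ and the ruin time is $\tau^\pi=\inf\{t\ge s:X^\pi_t<0\}$ ($\inf\emptyset=\infty$). $\pi$ is admissible, $\pi\in U_{ad}^{x,w}[s,T]$, if $L$ is $(\mathscr F_t)_{t\ge s}$-predictable, nondecreasing, càglàd, and dividends cannot cause bankruptcy: $L_t\le L_{t+}\le x+p(t-s)-Q^{s,w}_t$ for every $t\in[s,T]$ with $t<\tau^\pi$, and no dividends are paid at or after ruin. With $\mathbb E_{sxw}$ the expectation under $\mathbb P_{sw}$ with $X_s=x$, and $\int_s^{b+}$ denoting the integral over $[s,b]$ (lump sums at $s$ and $b$ included), $$J(s,x,w;\pi)=\mathbb E_{sxw}\Big[\int_s^{(\tau^\pi\wedge T)+}e^{-c(t-s)}dL_t^\pi\Big],\qquad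 V(s,x,w)=\sup_{\pi\in U_{ad}^{x,w}[s,T]}J(s,x,w;\pi).$$ The domain is $D=\{(s,x,w):0\le s\le T,\ x\ge0,\ 0\le w\le s\}$. *)

theory Defs
  imports "HOL-Probability.Probability"
begin

text \<open>
  Throughout, \<open>Y i\<close> and \<open>U i\<close> (\<open>i \<ge> 1\<close>; index 0 is never used) are the waiting times and the claim
  sizes of a Sparre Andersen risk model, \<open>p\<close> is the premium rate, \<open>c\<close> the discount factor and
  \<open>T\<close> the time horizon.
\<close>

definition claim_time :: "(nat \<Rightarrow> 'a \<Rightarrow> real) \<Rightarrow> nat \<Rightarrow> 'a \<Rightarrow> real" where
  "claim_time Y n \<omega> = (\<Sum>i=1..n. Y i \<omega>)"

definition claim_count :: "(nat \<Rightarrow> 'a \<Rightarrow> real) \<Rightarrow> real \<Rightarrow> 'a \<Rightarrow> nat" where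
  "claim_count Y t \<omega> = card {n. 1 \<le> n \<and> claim_time Y n \<omega> \<le> t}"

definition total_claims ::
  "(nat \<Rightarrow> 'a \<Rightarrow> real) \<Rightarrow> (nat \<Rightarrow> 'a \<Rightarrow> real) \<Rightarrow> real \<Rightarrow> 'a \<Rightarrow> real" where
  "total_claims Y U t \<omega> = (\<Sum>i=1..claim_count Y t \<omega>. U i \<omega>)"

definition elapsed :: "(nat \<Rightarrow> 'a \<Rightarrow> real) \<Rightarrow> real \<Rightarrow> 'a \<Rightarrow> real" where
  "elapsed Y t \<omega> = t - claim_time Y (claim_count Y t \<omega>) \<omega>"

text \<open>The raw filtration generated by \<open>N\<close>, \<open>Q\<close> and \<open>W\<close> on the sample space \<open>\<Omega>\<close>.\<close>

definition history ::
  "'a set \<Rightarrow> (nat \<Rightarrow> 'a \<Rightarrow> real) \<Rightarrow> (nat \<Rightarrow> 'a \<Rightarrow> real) \<Rightarrow> real \<Rightarrow> 'a measure" where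
  "history \<Omega> Y U t = sigma \<Omega>
     (\<Union>r\<in>{0..t}.
        {(\<lambda>\<omega>. real (claim_count Y r \<omega>)) -` B \<inter> \<Omega> | B. B \<in> sets borel} \<union>
        {total_claims Y U r -` B \<inter> \<Omega> | B. B \<in> sets borel} \<union>
        {elapsed Y r -` B \<inter> \<Omega> | B. B \<in> sets borel})"

text \<open>
  Augmentation by the null sets of the probability measure \<open>P\<close>. For the control problem started at
  \<open>(s, x, w)\<close>, \<open>P\<close> is the conditional law given \<open>W\<^sub>s = w\<close>. (The event \<open>W\<^sub>s = w\<close> is itself a null set
  of the unconditional law if \<open>w < s\<close>, so augmenting by the unconditional null sets would make every
  sub-event of it known at time \<open>s\<close>.)
\<close>

definition augmented_history ::
  "'a measure \<Rightarrow> (nat \<Rightarrow> 'a \<Rightarrow> real) \<Rightarrow> (nat \<Rightarrow> 'a \<Rightarrow> real) \<Rightarrow> real \<Rightarrow> 'a measure" where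
  "augmented_history P Y U t =
     sigma (space P) (sets (history (space P) Y U t) \<union> null_sets (completion P))"

definition predictable_algebra :: "real \<Rightarrow> 'a set \<Rightarrow> (real \<Rightarrow> 'a measure) \<Rightarrow> (real \<times> 'a) measure" where
  "predictable_algebra s \<Omega> \<F> = sigma ({s..} \<times> \<Omega>)
     ({{s} \<times> A | A. A \<in> sets (\<F> s)} \<union>
      {{a<..b} \<times> A | a b A. s \<le> a \<and> a < b \<and> A \<in> sets (\<F> a)})"

text \<open>
  The process after time \<open>s\<close>: \<open>wait_from Y s k\<close> is the \<open>k\<close>-th waiting time counted from \<open>s\<close> (for
  \<open>k = 1\<close> the residual one), \<open>claim_from Y U s k\<close> the \<open>k\<close>-th claim after \<open>s\<close>. The claims in
  \<open>Q\<^sup>s\<^sup>,\<^sup>w\<close> are thus the ones that occur after \<open>s\<close>, i.e. \<open>Q\<^sup>s\<^sup>,\<^sup>w\<^sub>t = Q\<^sub>t - Q\<^sub>s\<close>.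
\<close>

definition wait_from :: "(nat \<Rightarrow> 'a \<Rightarrow> real) \<Rightarrow> real \<Rightarrow> nat \<Rightarrow> 'a \<Rightarrow> real" where
  "wait_from Y s k \<omega> =
     (if k = 1 then claim_time Y (claim_count Y s \<omega> + 1) \<omega> - s
      else Y (claim_count Y s \<omega> + k) \<omega>)"

definition claim_from ::
  "(nat \<Rightarrow> 'a \<Rightarrow> real) \<Rightarrow> (nat \<Rightarrow> 'a \<Rightarrow> real) \<Rightarrow> real \<Rightarrow> nat \<Rightarrow> 'a \<Rightarrow> real" where
  "claim_from Y U s k \<omega> = U (claim_count Y s \<omega> + k) \<omega>"

definition total_claims_from ::
  "(nat \<Rightarrow> 'a \<Rightarrow> real) \<Rightarrow> (nat \<Rightarrow> 'a \<Rightarrow> real) \<Rightarrow> real \<Rightarrow> real \<Rightarrow> 'a \<Rightarrow> real" where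
  "total_claims_from Y U s t \<omega> =
     (\<Sum>k=1..claim_count Y t \<omega> - claim_count Y s \<omega>. claim_from Y U s k \<omega>)"

text \<open>
  The model. \<open>K s w\<close> is the regular conditional probability given \<open>W\<^sub>s = w\<close>. The disintegration
  property \<open>disintegration\<close> determines it only for almost every \<open>w\<close>; \<open>concentrated\<close> and the
  subsequent clauses fix, for every \<open>w \<in> {0..s}\<close>, a version under which the claims after \<open>s\<close> form a
  delayed renewal process that is independent of the history up to \<open>s\<close>.
\<close>

locale sparre_andersen = prob_space M
  for M :: "'a measure" +
  fixes T p c :: real
    and F f lam G :: "real \<Rightarrow> real"
    and Y U :: "nat \<Rightarrow> 'a \<Rightarrow> real"
    and K :: "real \<Rightarrow> real \<Rightarrow> 'a measure"
  assumes T_pos: "0 < T" and p_pos: "0 < p" and c_pos: "0 < c"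
    and wait_nonneg: "\<And>i \<omega>. 1 \<le> i \<Longrightarrow> \<omega> \<in> space M \<Longrightarrow> 0 \<le> Y i \<omega>"
    and claim_nonneg: "\<And>i \<omega>. 1 \<le> i \<Longrightarrow> \<omega> \<in> space M \<Longrightarrow> 0 \<le> U i \<omega>"
    and indep: "indep_vars (\<lambda>_. borel) (case_sum Y U) ({1..} <+> {1..})"
    and wait_cdf: "\<And>i. 1 \<le> i \<Longrightarrow> cdf (distr M borel (Y i)) = F"
    and claim_cdf: "\<And>i. 1 \<le> i \<Longrightarrow> cdf (distr M borel (U i)) = G"
    and f_nonneg: "\<And>t. 0 \<le> f t"
    and wait_density: "\<And>i. 1 \<le> i \<Longrightarrow> distributed M lborel (Y i) (\<lambda>t. ennreal (f t))"
    and F_cont: "continuous_on {0..} F"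
    and G_cont: "continuous_on {0..} G"
    and lam_cont: "continuous_on {0..} lam"
    and lam_nonneg: "\<And>t. 0 \<le> t \<Longrightarrow> 0 \<le> lam t"
    and lam_bounded: "bounded (lam ` {0..})"
    and survival: "\<And>t. 0 \<le> t \<Longrightarrow> 1 - F t = exp (- integral {0..t} lam)"
    and hazard: "\<And>t. t \<in> {0..T} \<Longrightarrow> lam t = f t / (1 - F t)"
    and hazard_pos: "\<And>t. t \<in> {0..T} \<Longrightarrow> 0 < lam t"
    and hazard_le: "\<exists>\<Lambda>>0. \<forall>t\<in>{0..T}. lam t \<le> \<Lambda>"
    and kernel: "\<And>s. s \<in> {0..T} \<Longrightarrow>
      K s \<in> restrict_space borel {0..s} \<rightarrow>\<^sub>M prob_algebra M"
    and disintegration: "\<And>s A B. s \<in> {0..T} \<Longrightarrow> A \<in> sets M \<Longrightarrow> B \<in> sets borel \<Longrightarrow>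
      measure M (A \<inter> {\<omega> \<in> space M. elapsed Y s \<omega> \<in> B}) =
      (\<integral>\<omega>. indicator B (elapsed Y s \<omega>) * measure (K s (elapsed Y s \<omega>)) A \<partial>M)"
    and concentrated: "\<And>s w. s \<in> {0..T} \<Longrightarrow> w \<in> {0..s} \<Longrightarrow> AE \<omega> in K s w. elapsed Y s \<omega> = w"
    and first_wait: "\<And>s w t. s \<in> {0..T} \<Longrightarrow> w \<in> {0..s} \<Longrightarrow> 0 \<le> t \<Longrightarrow>
      measure (K s w) {\<omega> \<in> space M. t < wait_from Y s 1 \<omega>} = exp (- integral {w..w+t} lam)"
    and later_waits: "\<And>s w k. s \<in> {0..T} \<Longrightarrow> w \<in> {0..s} \<Longrightarrow> 2 \<le> k \<Longrightarrow>
      cdf (distr (K s w) borel (wait_from Y s k)) = F"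
    and later_claims: "\<And>s w k. s \<in> {0..T} \<Longrightarrow> w \<in> {0..s} \<Longrightarrow> 1 \<le> k \<Longrightarrow>
      cdf (distr (K s w) borel (claim_from Y U s k)) = G"
    and indep_after: "\<And>s w. s \<in> {0..T} \<Longrightarrow> w \<in> {0..s} \<Longrightarrow>
      prob_space.indep_vars (K s w) (\<lambda>_. borel)
        (case_sum (wait_from Y s) (claim_from Y U s)) ({1..} <+> {1..})"
    and indep_history: "\<And>s w. s \<in> {0..T} \<Longrightarrow> w \<in> {0..s} \<Longrightarrow>
      prob_space.indep_set (K s w) (sets (history (space M) Y U s))
        (sets (vimage_algebra (space M)
          (\<lambda>\<omega>. \<lambda>i\<in>{1..} <+> {1..}. case_sum (wait_from Y s) (claim_from Y U s) i \<omega>)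
          (PiM ({1..} <+> {1..}) (\<lambda>_. borel :: real measure))))"

text \<open>
  A strategy \<open>L t \<omega>\<close> is considered for all \<open>t \<ge> s\<close>; a lump sum paid at the horizon \<open>T\<close> is encoded by
  \<open>L\<close> being constant, equal to \<open>L\<^sub>T\<^sub>+\<close>, on \<open>{T<..}\<close>. Right limits exist since \<open>L\<close> is nondecreasing.
\<close>

definition right_lim :: "(real \<Rightarrow> 'a \<Rightarrow> real) \<Rightarrow> real \<Rightarrow> 'a \<Rightarrow> real" where
  "right_lim L t \<omega> = Lim (at_right t) (\<lambda>r. L r \<omega>)"

definition wealth ::
  "real \<Rightarrow> (nat \<Rightarrow> 'a \<Rightarrow> real) \<Rightarrow> (nat \<Rightarrow> 'a \<Rightarrow> real) \<Rightarrow> real \<Rightarrow> real \<Rightarrow>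
   (real \<Rightarrow> 'a \<Rightarrow> real) \<Rightarrow> real \<Rightarrow> 'a \<Rightarrow> real" where
  "wealth p Y U s x L t \<omega> = x + p * (t - s) - total_claims_from Y U s t \<omega> - L t \<omega>"

definition ruin_time ::
  "real \<Rightarrow> (nat \<Rightarrow> 'a \<Rightarrow> real) \<Rightarrow> (nat \<Rightarrow> 'a \<Rightarrow> real) \<Rightarrow> real \<Rightarrow> real \<Rightarrow>
   (real \<Rightarrow> 'a \<Rightarrow> real) \<Rightarrow> 'a \<Rightarrow> ereal" where
  "ruin_time p Y U s x L \<omega> = Inf (ereal ` {t. s \<le> t \<and> wealth p Y U s x L t \<omega> < 0})"

definition admissible ::
  "real \<Rightarrow> real \<Rightarrow> (nat \<Rightarrow> 'a \<Rightarrow> real) \<Rightarrow> (nat \<Rightarrow> 'a \<Rightarrow> real) \<Rightarrow> 'a measure \<Rightarrow>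
   real \<Rightarrow> real \<Rightarrow> (real \<Rightarrow> 'a \<Rightarrow> real) \<Rightarrow> bool" where
  "admissible T p Y U P s x L \<longleftrightarrow>
     (\<lambda>(t, \<omega>). L t \<omega>) \<in> borel_measurable
        (predictable_algebra s (space P) (augmented_history P Y U)) \<and>
     (\<forall>\<omega>\<in>space P.
        L s \<omega> = 0 \<and>
        mono_on {s..} (\<lambda>t. L t \<omega>) \<and>
        (\<forall>t>s. continuous (at_left t) (\<lambda>r. L r \<omega>)) \<and>
        (\<forall>t>T. L t \<omega> = right_lim L T \<omega>)) \<and>
     (AE \<omega> in P. \<forall>t\<in>{s..T}.
        (ereal t < ruin_time p Y U s x L \<omega> \<longrightarrow>
           L t \<omega> \<le> right_lim L t \<omega> \<and>
           right_lim L t \<omega> \<le> x + p * (t - s) - total_claims_from Y U s t \<omega>) \<and>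
        (ruin_time p Y U s x L \<omega> \<le> ereal t \<longrightarrow>
           right_lim L t \<omega> = L (real_of_ereal (ruin_time p Y U s x L \<omega>)) \<omega>))"

text \<open>
  The Stieltjes measure \<open>dL\<close> on \<open>{s..}\<close> is that of the right-continuous modification \<open>L\<^sub>t\<^sub>+\<close>, extended
  by 0 to the left of \<open>s\<close>, so that it charges \<open>s\<close> with the initial lump sum \<open>L\<^sub>s\<^sub>+\<close>.
\<close>

definition discounted_dividends ::
  "real \<Rightarrow> real \<Rightarrow> real \<Rightarrow> (nat \<Rightarrow> 'a \<Rightarrow> real) \<Rightarrow> (nat \<Rightarrow> 'a \<Rightarrow> real) \<Rightarrow>
   real \<Rightarrow> real \<Rightarrow> (real \<Rightarrow> 'a \<Rightarrow> real) \<Rightarrow> 'a \<Rightarrow> real" where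
  "discounted_dividends T p c Y U s x L \<omega> =
     (LINT t:{s..real_of_ereal (min (ruin_time p Y U s x L \<omega>) (ereal T))} |
        interval_measure (\<lambda>t. if t < s then 0 else right_lim L t \<omega>).
        exp (- c * (t - s)))"

text \<open>
  The expectation is taken in the completion of \<open>P\<close>, because strategies are adapted to an augmented
  filtration.
\<close>

definition dividend_payoff ::
  "real \<Rightarrow> real \<Rightarrow> real \<Rightarrow> (nat \<Rightarrow> 'a \<Rightarrow> real) \<Rightarrow> (nat \<Rightarrow> 'a \<Rightarrow> real) \<Rightarrow> 'a measure \<Rightarrow>
   real \<Rightarrow> real \<Rightarrow> (real \<Rightarrow> 'a \<Rightarrow> real) \<Rightarrow> real" where
  "dividend_payoff T p c Y U P s x L =
     (\<integral>\<omega>. discounted_dividends T p c Y U s x L \<omega> \<partial>completion P)"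

text \<open>
  The supremum is over a nonempty set (\<open>L = 0\<close> is admissible) that is bounded by \<open>x + p * (T - s)\<close>.
\<close>

definition value_fn ::
  "real \<Rightarrow> real \<Rightarrow> real \<Rightarrow> (nat \<Rightarrow> 'a \<Rightarrow> real) \<Rightarrow> (nat \<Rightarrow> 'a \<Rightarrow> real) \<Rightarrow>
   (real \<Rightarrow> real \<Rightarrow> 'a measure) \<Rightarrow> real \<Rightarrow> real \<Rightarrow> real \<Rightarrow> real" where
  "value_fn T p c Y U K s x w =
     (SUP L\<in>{L. admissible T p Y U (K s w) s x L}. dividend_payoff T p c Y U (K s w) s x L)"

definition domain :: "real \<Rightarrow> (real \<times> real \<times> real) set" where
  "domain T = {(s, x, w). 0 \<le> s \<and> s \<le> T \<and> 0 \<le> x \<and> 0 \<le> w \<and> w \<le> s}"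

end

theory Submission
  imports Defs
begin

text \<open>
  Both parts compare strategies for two initial wealths path by path, under one and the same
  conditional law \<open>K s w\<close>.

  For part (1), let \<open>L\<close> be admissible from wealth \<open>x\<^sub>2\<close>. Paying the difference \<open>x\<^sub>1 - x\<^sub>2\<close> at once at
  time \<open>s\<close> and following \<open>L\<close> from then on is admissible from \<open>x\<^sub>1\<close>: after \<open>s\<close> the wealth is the same,
  so the ruin time is the same, and a payment at time \<open>s\<close> is never a payment after ruin, because
  the first claim comes strictly after \<open>s\<close> almost surely. The payoff grows by \<open>x\<^sub>1 - x\<^sub>2\<close>.

  For part (2), let \<open>L\<close> be admissible from wealth \<open>x + d\<close>. Starting from \<open>x\<close>, keep the first \<open>d\<close> units
  that \<open>L\<close> would pay, and pay what exceeds them, \<open>(L - d)\<^sup>+\<close>, as long as the wealth without any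
  dividends has not been ruined. This strategy, called \<open>withhold\<close> below, is admissible from \<open>x\<close>, and it
  costs at most \<open>d\<close> in payoff unless it is ruined earlier than \<open>L\<close>. That can happen only at a claim
  at which the loss accumulated since \<open>s\<close>, i.e. claims minus premiums, falls into a window of length
  of order \<open>d\<close> just above \<open>x\<close>. At the \<open>n\<close>-th claim the loss has the form \<open>Z - p W\<close>, where the first
  waiting time \<open>W\<close> is independent of \<open>Z\<close> and its hazard rate is bounded; hence the loss hits the window
  with probability of order \<open>d\<close>, uniformly in \<open>n\<close>, \<open>s\<close>, \<open>w\<close> and \<open>x\<close>. More than \<open>N\<close> claims before \<open>T\<close>
  have probability at most \<open>F(T)\<^sup>N\<close>, and \<open>F(T) < 1\<close>. Choosing first \<open>N\<close> large and then \<open>d\<close> small bounds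
  \<open>V(s, x + d, w) - V(s, x, w)\<close> uniformly on bounded sets of \<open>x\<close>; the estimate is \<open>value_diff_le\<close>.

  Two facts about payoffs support this. Since no dividends are paid after ruin, the ruin time drops
  out of the payoff, and integration by parts turns the Stieltjes integral into
  \<open>exp (- c (T - s)) L\<^sub>T\<^sub>+ + \<integral> c exp (- c (u - s)) L\<^sub>u\<^sub>+ du\<close>, which is visibly monotone in the path of \<open>L\<close>
  and measurable in the
  sample point. And \<open>withhold\<close> is written as a supremum of adapted payments over earlier rational
  times, which makes it nondecreasing, left-continuous and predictable at once.
\<close>

section \<open>Right limits of dividend paths\<close>

text \<open>
  The conditions that \<open>admissible\<close> imposes on the path of a strategy at every sample point.
\<close>

locale dividend_path =
  fixes s :: real and L :: "real \<Rightarrow> 'a \<Rightarrow> real" and \<omega> :: 'a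
  assumes start: "L s \<omega> = 0"
    and mono: "mono_on {s..} (\<lambda>t. L t \<omega>)"
    and left_cont: "\<And>t. s < t \<Longrightarrow> continuous (at_left t) (\<lambda>r. L r \<omega>)"
begin

lemma le: "s \<le> t \<Longrightarrow> t \<le> r \<Longrightarrow> L t \<omega> \<le> L r \<omega>"
  using mono by (auto intro: mono_onD)

lemma nonneg: "s \<le> t \<Longrightarrow> 0 \<le> L t \<omega>"
  using le[of s t] start by simp

lemma right_lim_tendsto:
  assumes "s \<le> t"
  shows "((\<lambda>r. L r \<omega>) \<longlongrightarrow> right_lim L t \<omega>) (at_right t)"
proof -
  have "((\<lambda>r. L r \<omega>) \<longlongrightarrow> Inf ((\<lambda>r. L r \<omega>) ` ({t<..} \<inter> UNIV))) (at t within ({t<..} \<inter> UNIV))"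
    using assms by (intro Lim_right_bound[where K="L t \<omega>"]) (auto intro!: le)
  then show ?thesis
    unfolding right_lim_def by (metis Int_UNIV_right tendsto_Lim trivial_limit_at_right_real)
qed

lemma right_lim_le:
  assumes "s \<le> t" "t < r"
  shows "right_lim L t \<omega> \<le> L r \<omega>"
proof (rule tendsto_upperbound[OF right_lim_tendsto[OF \<open>s \<le> t\<close>]])
  show "\<forall>\<^sub>F u in at_right t. L u \<omega> \<le> L r \<omega>"
    unfolding eventually_at_right_field
    using assms by (intro exI[of _ r]) (auto intro!: le)
qed simp

lemma right_lim_greatest:
  assumes "s \<le> t" and bound: "\<And>r. t < r \<Longrightarrow> K \<le> L r \<omega>"
  shows "K \<le> right_lim L t \<omega>"
proof (rule tendsto_lowerbound[OF right_lim_tendsto[OF \<open>s \<le> t\<close>]])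
  show "\<forall>\<^sub>F u in at_right t. K \<le> L u \<omega>"
    by (auto simp: eventually_at_filter intro!: always_eventually bound)
qed simp

lemma right_lim_ge:
  assumes "s \<le> t"
  shows "L t \<omega> \<le> right_lim L t \<omega>"
  using assms by (intro right_lim_greatest) (auto intro!: le)

lemma right_lim_mono:
  assumes "s \<le> t" "t \<le> r"
  shows "right_lim L t \<omega> \<le> right_lim L r \<omega>"
  using assms right_lim_le right_lim_ge
  by (cases "t = r") (auto intro: order_trans[where y="L r \<omega>"])

text \<open>
  The extension of \<open>L\<^sub>t\<^sub>+\<close> by 0 is the distribution function of the Stieltjes measure \<open>dL\<close>; this lemma
  and the next one are what is needed for \<open>interval_measure\<close> to have the right increments.
\<close>

lemma right_lim_extension_mono:
  assumes "x \<le> y"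
  shows "(if x < s then 0 else right_lim L x \<omega>) \<le> (if y < s then 0 else right_lim L y \<omega>)"
proof -
  have "0 \<le> right_lim L y \<omega>" if "s \<le> y"
    using that right_lim_ge[OF that] nonneg[of y] by auto
  then show ?thesis
    using assms right_lim_mono[of x y] by auto
qed

lemma right_lim_extension_right_continuous:
  shows "continuous (at_right a) (\<lambda>t. if t < s then 0 else right_lim L t \<omega>)"
proof (cases "a < s")
  case True
  then have "\<forall>\<^sub>F t in at_right a. (if t < s then 0 else right_lim L t \<omega>) = 0"
    unfolding eventually_at_right_field by (intro exI[of _ s]) auto
  then show ?thesis
    using True by (simp add: continuous_within tendsto_eventually)
next
  case False
  then have "s \<le> a" by simp
  have "((\<lambda>t. if t < s then 0 else right_lim L t \<omega>) \<longlongrightarrow> right_lim L a \<omega>) (at_right a)"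
  proof (rule order_tendstoI)
    fix y assume "y < right_lim L a \<omega>"
    then show "\<forall>\<^sub>F t in at_right a. y < (if t < s then 0 else right_lim L t \<omega>)"
      unfolding eventually_at_right_field using \<open>s \<le> a\<close> right_lim_mono[OF \<open>s \<le> a\<close>]
      by (intro exI[of _ "a + 1"]) (force intro: less_le_trans)
  next
    fix y assume "right_lim L a \<omega> < y"
    then have "\<forall>\<^sub>F t in at_right a. L t \<omega> < y"
      using right_lim_tendsto[OF \<open>s \<le> a\<close>] by (simp add: order_tendsto_iff)
    then obtain b where b: "b > a" "\<And>t. a < t \<Longrightarrow> t < b \<Longrightarrow> L t \<omega> < y"
      unfolding eventually_at_right_field by auto
    have "right_lim L t \<omega> < y" if t: "a < t" "t < b" for t
    proof -
      have "right_lim L t \<omega> \<le> L ((t + b) / 2) \<omega>"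
        using t \<open>s \<le> a\<close> by (intro right_lim_le) auto
      also have "\<dots> < y"
        using t by (intro b(2)) auto
      finally show ?thesis .
    qed
    then show "\<forall>\<^sub>F t in at_right a. (if t < s then 0 else right_lim L t \<omega>) < y"
      unfolding eventually_at_right_field using \<open>s \<le> a\<close> b(1) by (intro exI[of _ b]) auto
  qed
  then show ?thesis
    using False by (simp add: continuous_within)
qed

end

section \<open>Integration by parts against the discount factor\<close>

text \<open>
  A jump of \<open>h\<close> at \<open>s\<close> is an atom at \<open>s\<close>, so that an interval that is closed at \<open>s\<close> carries all of
  \<open>h b\<close>: to the left of \<open>s\<close> there is no mass.
\<close>

lemma emeasure_interval_measure_from_start:
  assumes mono: "\<And>x y. x \<le> y \<Longrightarrow> h x \<le> h y" and rc: "\<And>a. continuous (at_right a) h"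
    and zero: "\<And>t. t < s \<Longrightarrow> h t = 0" and "s \<le> b"
  shows "emeasure (interval_measure h) {s..b} = ennreal (h b)"
proof -
  let ?\<mu> = "interval_measure h"
  have "emeasure ?\<mu> (\<Union>n. {s - 1<..s - 1 / (real n + 1)}) = 0"
  proof (rule emeasure_UN_eq_0)
    show "emeasure ?\<mu> {s - 1<..s - 1 / (real n + 1)} = 0" for n
      by (subst emeasure_interval_measure_Ioc) (auto simp: mono rc zero)
  qed auto
  moreover have "(\<Union>n. {s - 1<..s - 1 / (real n + 1)}) = {s - 1<..<s}"
  proof safe
    fix x assume x: "x \<in> {s - 1<..<s}"
    then have "0 < s - x" by simp
    then obtain n where "inverse (real (Suc n)) < s - x"
      using reals_Archimedean by blast
    then show "x \<in> (\<Union>n. {s - 1<..s - 1 / (real n + 1)})"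
      using x by (auto simp: inverse_eq_divide add.commute intro!: bexI[of _ n] exI[of _ n])
  qed (auto intro: le_less_trans)
  ultimately have null: "emeasure ?\<mu> {s - 1<..<s} = 0" by simp
  have "emeasure ?\<mu> {s..b} = emeasure ?\<mu> {s - 1<..<s} + emeasure ?\<mu> {s..b}"
    using null by simp
  also have "\<dots> = emeasure ?\<mu> ({s - 1<..<s} \<union> {s..b})"
    by (intro plus_emeasure) auto
  also have "{s - 1<..<s} \<union> {s..b} = {s - 1<..b}"
    using \<open>s \<le> b\<close> by auto
  also have "emeasure ?\<mu> {s - 1<..b} = h b"
    using \<open>s \<le> b\<close> by (subst emeasure_interval_measure_Ioc) (auto simp: mono rc zero)
  finally show ?thesis .
qed

lemma discount_eq_integral:
  assumes "t \<le> T" "(0::real) < c"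
  shows "ennreal (exp (- c * (t - s))) =
    ennreal (exp (- c * (T - s))) + (\<integral>\<^sup>+u. ennreal (c * exp (- c * (u - s))) * indicator {t..T} u \<partial>lborel)"
proof -
  have "(\<integral>\<^sup>+u. ennreal (c * exp (- c * (u - s))) * indicator {t..T} u \<partial>lborel) =
      ennreal (- exp (- c * (T - s)) - (- exp (- c * (t - s))))"
    using assms
    by (intro nn_integral_FTC_Icc) (auto intro!: derivative_eq_intros)
  also have "ennreal (exp (- c * (T - s))) + \<dots> = ennreal (exp (- c * (t - s)))"
    using assms by (subst ennreal_plus[symmetric]) (auto simp: mult_left_mono)
  finally show ?thesis by simp
qed

lemma set_integrable_discounted:
  fixes h :: "real \<Rightarrow> real"
  assumes mono: "\<And>x y. x \<le> y \<Longrightarrow> h x \<le> h y" and nonneg: "\<And>u. 0 \<le> h u" and "0 < c"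
  shows "set_integrable lborel {s..T} (\<lambda>u. c * exp (- c * (u - s)) * h u)"
  unfolding set_integrable_def
proof (rule Bochner_Integration.integrable_bound)
  have [measurable]: "h \<in> borel_measurable borel"
    by (intro borel_measurable_mono monoI mono)
  show "(\<lambda>u. indicator {s..T} u *\<^sub>R (c * exp (- c * (u - s)) * h u)) \<in> borel_measurable lborel"
    by measurable
  show "integrable lborel (\<lambda>u. (c * h T) * indicator {s..T} u)"
    by (intro integrable_mult_right integrable_real_indicator) (simp_all add: emeasure_lborel_Icc_eq)
  show "AE u in lborel. norm (indicator {s..T} u *\<^sub>R (c * exp (- c * (u - s)) * h u))
      \<le> norm (c * h T * indicator {s..T} u)"
  proof (intro AE_I2)
    fix u
    have "exp (- c * (u - s)) * h u \<le> 1 * h T" if "s \<le> u" "u \<le> T"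
      using that \<open>0 < c\<close> nonneg mono[of u T] by (intro mult_mono) auto
    then show "norm (indicator {s..T} u *\<^sub>R (c * exp (- c * (u - s)) * h u))
        \<le> norm (c * h T * indicator {s..T} u)"
      using \<open>0 < c\<close> nonneg by (auto simp: indicator_def abs_mult mult.assoc)
  qed
qed

text \<open>
  Integration by parts, as an instance of Fubini's theorem: \<open>exp (- c * (t - s))\<close> is written as its value at \<open>T\<close> plus an
  integral over \<open>u \<in> {t..T}\<close>, and the set of all \<open>t \<le> u\<close> has mass \<open>h u\<close>.
\<close>

lemma integral_discount_interval_measure:
  fixes h :: "real \<Rightarrow> real"
  assumes mono: "\<And>x y. x \<le> y \<Longrightarrow> h x \<le> h y" and rc: "\<And>a. continuous (at_right a) h"
    and zero: "\<And>t. t < s \<Longrightarrow> h t = 0" and "s \<le> T" "0 < c"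
  shows "(LINT t:{s..T}|interval_measure h. exp (- c * (t - s))) =
    exp (- c * (T - s)) * h T + (LINT u:{s..T}|lborel. c * exp (- c * (u - s)) * h u)"
proof -
  let ?\<mu> = "interval_measure h"
  interpret \<mu>: sigma_finite_measure ?\<mu>
    by (rule sigma_finite_interval_measure[OF mono rc])
  interpret pair_sigma_finite ?\<mu> lborel ..
  have nonneg: "0 \<le> h u" for u
    using mono[of "min u (s - 1)" u] zero[of "min u (s - 1)"] by simp
  have [measurable]: "h \<in> borel_measurable borel"
    by (intro borel_measurable_mono monoI mono)
  have cell: "emeasure ?\<mu> {s..b} = ennreal (h b)" if "s \<le> b" for b
    using that by (intro emeasure_interval_measure_from_start mono rc zero) auto
  have "(\<integral>\<^sup>+t. ennreal (exp (- c * (t - s))) * indicator {s..T} t \<partial>?\<mu>) =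
      (\<integral>\<^sup>+t. ennreal (exp (- c * (T - s))) * indicator {s..T} t +
        (\<integral>\<^sup>+u. ennreal (c * exp (- c * (u - s))) * (indicator {t..T} u * indicator {s..T} t) \<partial>lborel) \<partial>?\<mu>)"
  proof (intro nn_integral_cong)
    fix t
    show "ennreal (exp (- c * (t - s))) * indicator {s..T} t =
      ennreal (exp (- c * (T - s))) * indicator {s..T} t +
        (\<integral>\<^sup>+u. ennreal (c * exp (- c * (u - s))) * (indicator {t..T} u * indicator {s..T} t) \<partial>lborel)"
    proof (cases "t \<in> {s..T}")
      case True
      then show ?thesis
        using discount_eq_integral[of t T c s] \<open>0 < c\<close> by simp
    qed simp
  qed
  also have "\<dots> = ennreal (exp (- c * (T - s))) * emeasure ?\<mu> {s..T} +
      (\<integral>\<^sup>+t. (\<integral>\<^sup>+u. ennreal (c * exp (- c * (u - s))) * (indicator {t..T} u * indicator {s..T} t) \<partial>lborel) \<partial>?\<mu>)"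
  proof (subst nn_integral_add)
    show "(\<lambda>t. \<integral>\<^sup>+u. ennreal (c * exp (- c * (u - s))) * (indicator {t..T} u * indicator {s..T} t) \<partial>lborel)
        \<in> borel_measurable ?\<mu>"
      by (rule lborel.borel_measurable_nn_integral) (simp add: indicator_def split_beta', measurable)
  qed (auto simp: nn_integral_cmult)
  also have "(\<integral>\<^sup>+t. (\<integral>\<^sup>+u. ennreal (c * exp (- c * (u - s))) * (indicator {t..T} u * indicator {s..T} t) \<partial>lborel) \<partial>?\<mu>) =
      (\<integral>\<^sup>+u. (\<integral>\<^sup>+t. ennreal (c * exp (- c * (u - s))) * (indicator {t..T} u * indicator {s..T} t) \<partial>?\<mu>) \<partial>lborel)"
    by (rule Fubini'[symmetric]) (simp add: indicator_def split_beta', measurable)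
  also have "\<dots> = (\<integral>\<^sup>+u. ennreal (c * exp (- c * (u - s)) * h u * indicator {s..T} u) \<partial>lborel)"
  proof (intro nn_integral_cong)
    fix u
    have "(\<integral>\<^sup>+t. ennreal (c * exp (- c * (u - s))) * (indicator {t..T} u * indicator {s..T} t) \<partial>?\<mu>) =
        (\<integral>\<^sup>+t. (ennreal (c * exp (- c * (u - s))) * indicator {s..T} u) * indicator {s..u} t \<partial>?\<mu>)"
      by (intro nn_integral_cong) (auto simp: indicator_def)
    also have "\<dots> = (ennreal (c * exp (- c * (u - s))) * indicator {s..T} u) * emeasure ?\<mu> {s..u}"
      by (subst nn_integral_cmult) auto
    also have "\<dots> = ennreal (c * exp (- c * (u - s)) * h u * indicator {s..T} u)"
      using \<open>0 < c\<close> by (auto simp: cell indicator_def ennreal_mult' nonneg)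
    finally show "(\<integral>\<^sup>+t. ennreal (c * exp (- c * (u - s))) * (indicator {t..T} u * indicator {s..T} t) \<partial>?\<mu>) =
      ennreal (c * exp (- c * (u - s)) * h u * indicator {s..T} u)" .
  qed
  finally have eq: "(\<integral>\<^sup>+t. ennreal (exp (- c * (t - s))) * indicator {s..T} t \<partial>?\<mu>) =
      ennreal (exp (- c * (T - s)) * h T) +
      (\<integral>\<^sup>+u. ennreal (c * exp (- c * (u - s)) * h u * indicator {s..T} u) \<partial>lborel)"
    by (simp add: cell \<open>s \<le> T\<close> ennreal_mult nonneg)
  have int: "set_integrable lborel {s..T} (\<lambda>u. c * exp (- c * (u - s)) * h u)"
    using mono nonneg \<open>0 < c\<close> by (rule set_integrable_discounted)
  let ?I = "LINT u:{s..T}|lborel. c * exp (- c * (u - s)) * h u"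
  have I: "0 \<le> ?I"
    unfolding set_lebesgue_integral_def using \<open>0 < c\<close> nonneg by (intro integral_nonneg_AE) auto
  have "(\<integral>\<^sup>+u. ennreal (c * exp (- c * (u - s)) * h u * indicator {s..T} u) \<partial>lborel) = ennreal ?I"
    unfolding set_lebesgue_integral_def
    using int \<open>0 < c\<close> nonneg
    by (subst nn_integral_eq_integral[symmetric])
       (auto simp: set_integrable_def mult.commute)
  then have "(\<integral>\<^sup>+t. ennreal (exp (- c * (t - s))) * indicator {s..T} t \<partial>?\<mu>) =
      ennreal (exp (- c * (T - s)) * h T + ?I)"
    using I nonneg unfolding eq by (simp add: ennreal_plus)
  moreover have "(LINT t:{s..T}|?\<mu>. exp (- c * (t - s))) =
      enn2real (\<integral>\<^sup>+t. ennreal (exp (- c * (t - s))) * indicator {s..T} t \<partial>?\<mu>)"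
    unfolding set_lebesgue_integral_def
    by (subst integral_eq_nn_integral)
       (auto intro!: arg_cong[where f=enn2real] nn_integral_cong simp: indicator_def)
  ultimately show ?thesis
    using I nonneg by (simp only: enn2real_ennreal add_nonneg_nonneg mult_nonneg_nonneg exp_ge_zero)
qed

section \<open>Claim paths\<close>

text \<open>
  The claim times must be unbounded because \<open>claim_count\<close> is a cardinality: on a path with infinitely
  many claims up to time \<open>t\<close> it would be 0.
\<close>

locale claims_path =
  fixes Y U :: "nat \<Rightarrow> 'a \<Rightarrow> real" and s :: real and \<omega> :: 'a
  assumes wait_nonneg: "\<And>i. 1 \<le> i \<Longrightarrow> 0 \<le> Y i \<omega>"
    and claim_nonneg: "\<And>i. 1 \<le> i \<Longrightarrow> 0 \<le> U i \<omega>"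
    and claim_times_unbounded: "\<And>t. \<exists>n. t < claim_time Y n \<omega>"
begin

abbreviation claims :: "real \<Rightarrow> real" where
  "claims t \<equiv> total_claims_from Y U s t \<omega>"

lemma claim_time_mono: "m \<le> n \<Longrightarrow> claim_time Y m \<omega> \<le> claim_time Y n \<omega>"
  unfolding claim_time_def by (intro sum_mono2) (auto intro: wait_nonneg)

lemma claims_up_to: "{n. 1 \<le> n \<and> claim_time Y n \<omega> \<le> t} = {1..claim_count Y t \<omega>}"
proof -
  let ?S = "{n. 1 \<le> n \<and> claim_time Y n \<omega> \<le> t}"
  obtain m where m: "t < claim_time Y m \<omega>"
    using claim_times_unbounded by blast
  have "n < m" if "n \<in> ?S" for n
    using that m claim_time_mono[of m n] by (cases "n < m") auto
  then have fin: "finite ?S"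
    by (intro finite_subset[of ?S "{..<m}"]) auto
  have "\<exists>k. ?S = {1..k}"
  proof (cases "?S = {}")
    case True
    then show ?thesis by (intro exI[of _ 0]) simp
  next
    case False
    have "?S = {1..Max ?S}"
    proof safe
      fix n assume n: "n \<in> {1..Max ?S}"
      have "claim_time Y n \<omega> \<le> claim_time Y (Max ?S) \<omega>"
        using n by (intro claim_time_mono) auto
      then show "1 \<le> n" "claim_time Y n \<omega> \<le> t"
        using n Max_in[OF fin False] by auto
    qed (use fin in auto)
    then show ?thesis by blast
  qed
  then obtain k where "?S = {1..k}" by blast
  then show ?thesis
    by (simp add: claim_count_def)
qed

lemma le_claim_count_iff: "1 \<le> n \<Longrightarrow> n \<le> claim_count Y t \<omega> \<longleftrightarrow> claim_time Y n \<omega> \<le> t"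
  using claims_up_to[of t] by (auto simp: set_eq_iff)

lemma claim_count_mono: "t \<le> r \<Longrightarrow> claim_count Y t \<omega> \<le> claim_count Y r \<omega>"
  using le_claim_count_iff[of "claim_count Y t \<omega>" t] le_claim_count_iff[of "claim_count Y t \<omega>" r]
  by (cases "claim_count Y t \<omega> = 0") auto

lemma less_claim_time_Suc_count: "t < claim_time Y (Suc (claim_count Y t \<omega>)) \<omega>"
  using le_claim_count_iff[of "Suc (claim_count Y t \<omega>)" t] by simp

lemma claim_count_locally_constant:
  assumes "t \<le> r" "r < claim_time Y (Suc (claim_count Y t \<omega>)) \<omega>"
  shows "claim_count Y r \<omega> = claim_count Y t \<omega>"
proof (rule antisym)
  show "claim_count Y r \<omega> \<le> claim_count Y t \<omega>"
    using assms le_claim_count_iff[of "Suc (claim_count Y t \<omega>)" r] by simp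
qed (use assms claim_count_mono in simp)

lemma total_claims_from_eq:
  "claims t = (\<Sum>k=1..claim_count Y t \<omega> - claim_count Y s \<omega>. U (claim_count Y s \<omega> + k) \<omega>)"
  by (simp add: total_claims_from_def claim_from_def)

lemma total_claims_from_eq_diff:
  assumes "s \<le> t"
  shows "claims t = total_claims Y U t \<omega> - total_claims Y U s \<omega>"
proof -
  let ?m = "claim_count Y s \<omega>" and ?n = "claim_count Y t \<omega>"
  have "?m \<le> ?n" using assms by (rule claim_count_mono)
  then have "{1..?n} = {1..?m} \<union> {?m + 1..?n}" by auto
  then have "total_claims Y U t \<omega> = total_claims Y U s \<omega> + (\<Sum>i=?m + 1..?n. U i \<omega>)"
    by (simp add: total_claims_def sum.union_disjoint)
  also have "(\<Sum>i=?m + 1..?n. U i \<omega>) = (\<Sum>k=1..?n - ?m. U (?m + k) \<omega>)"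
    using \<open>?m \<le> ?n\<close> sum.shift_bounds_cl_nat_ivl[of "\<lambda>i. U i \<omega>" 1 ?m "?n - ?m"]
    by (simp add: add.commute)
  finally show ?thesis
    by (simp add: total_claims_from_eq)
qed

lemma claims_nonneg: "0 \<le> claims t"
  unfolding total_claims_from_eq by (intro sum_nonneg claim_nonneg) auto

lemma claims_start: "claims s = 0"
  by (simp add: total_claims_from_eq)

lemma claims_right_constant:
  obtains b where "t < b" "\<And>r. t \<le> r \<Longrightarrow> r < b \<Longrightarrow> claims r = claims t"
proof (rule that)
  show "t < claim_time Y (Suc (claim_count Y t \<omega>)) \<omega>"
    by (rule less_claim_time_Suc_count)
  show "claims r = claims t" if "t \<le> r" "r < claim_time Y (Suc (claim_count Y t \<omega>)) \<omega>" for r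
    unfolding total_claims_from_eq claim_count_locally_constant[OF that] ..
qed

lemma claim_time_after_start:
  assumes "1 \<le> n"
  shows "claim_time Y (claim_count Y s \<omega> + n) \<omega> = s + (\<Sum>k=1..n. wait_from Y s k \<omega>)"
  using assms
proof (induction n rule: dec_induct)
  case base
  then show ?case by (simp add: wait_from_def)
next
  case (step n)
  have "claim_time Y (claim_count Y s \<omega> + Suc n) \<omega> =
      claim_time Y (claim_count Y s \<omega> + n) \<omega> + Y (claim_count Y s \<omega> + Suc n) \<omega>"
    by (simp add: claim_time_def)
  with step show ?case by (simp add: wait_from_def)
qed

text \<open>
  Between claims the wealth without dividends increases. If it is negative at time \<open>r\<close>, it therefore
  became negative at a claim, and the last claim up to time \<open>r\<close> is the witness used later.
\<close>

lemma last_claim_before: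
  assumes "s \<le> r" "0 < claims r"
  obtains n where "1 \<le> n" "s < s + (\<Sum>k=1..n. wait_from Y s k \<omega>)"
    "s + (\<Sum>k=1..n. wait_from Y s k \<omega>) \<le> r"
    "claims (s + (\<Sum>k=1..n. wait_from Y s k \<omega>)) = claims r"
    "claims r = (\<Sum>k=1..n. claim_from Y U s k \<omega>)"
proof -
  let ?N = "\<lambda>t. claim_count Y t \<omega>"
  let ?n = "?N r - ?N s"
  have n: "1 \<le> ?n"
    using assms(2) by (cases "?N r - ?N s") (auto simp: total_claims_from_eq)
  define \<sigma> where "\<sigma> = claim_time Y (?N r) \<omega>"
  have \<sigma>: "\<sigma> = s + (\<Sum>k=1..?n. wait_from Y s k \<omega>)"
    using claim_time_after_start[OF n] n by (simp add: \<sigma>_def)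
  have "1 \<le> ?N r" "\<not> ?N r \<le> ?N s" using n by auto
  then have "\<sigma> \<le> r" "s < \<sigma>"
    using le_claim_count_iff[of "?N r" r] le_claim_count_iff[of "?N r" s]
    by (auto simp: \<sigma>_def not_le[symmetric])
  moreover have "?N \<sigma> = ?N r"
    using claim_count_mono[OF \<open>\<sigma> \<le> r\<close>] le_claim_count_iff[of "?N r" \<sigma>] n by (auto simp: \<sigma>_def)
  moreover from this have "claims \<sigma> = claims r"
    by (simp add: total_claims_from_def)
  moreover have "claims r = (\<Sum>k=1..?n. claim_from Y U s k \<omega>)"
    by (simp add: total_claims_from_def)
  ultimately show ?thesis
    using n unfolding \<sigma> by (rule_tac that[of ?n])
qed

lemma wait_from_nonneg: "1 \<le> k \<Longrightarrow> 0 \<le> wait_from Y s k \<omega>"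
  using less_claim_time_Suc_count[of s] by (auto simp: wait_from_def intro: wait_nonneg)

end

text \<open>
  If infinitely many claims occurred in bounded time, all later waiting times would be bounded, which
  has probability 0 for independent waiting times. This gives the unboundedness in \<open>claims_path\<close>.
\<close>

lemma waits_bounded_if_claim_times_bounded:
  assumes nonneg: "\<And>i. 1 \<le> i \<Longrightarrow> 0 \<le> Y i \<omega>" and le: "\<And>n. claim_time Y n \<omega> \<le> t" and "2 \<le> k"
  shows "wait_from Y s k \<omega> \<le> t"
proof -
  have "Y (claim_count Y s \<omega> + k) \<omega> \<le> claim_time Y (claim_count Y s \<omega> + k) \<omega>"
    unfolding claim_time_def using \<open>2 \<le> k\<close>
    by (intro member_le_sum) (auto intro: nonneg)
  also have "\<dots> \<le> t" by (rule le)
  finally show ?thesis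
    using \<open>2 \<le> k\<close> by (simp add: wait_from_def)
qed

section \<open>Ruin\<close>

lemma ruin_time_le:
  assumes "s \<le> t" "wealth p Y U s x L t \<omega> < 0"
  shows "ruin_time p Y U s x L \<omega> \<le> ereal t"
  unfolding ruin_time_def using assms by (intro Inf_lower) auto

lemma wealth_nonneg_before_ruin:
  assumes "s \<le> t" "ereal t < ruin_time p Y U s x L \<omega>"
  shows "0 \<le> wealth p Y U s x L t \<omega>"
  using assms ruin_time_le[of s t p Y U x L \<omega>] by (auto simp flip: not_less)

lemma ruin_time_ge_start: "ereal s \<le> ruin_time p Y U s x L \<omega>"
  unfolding ruin_time_def by (rule Inf_greatest) auto

lemma ruin_time_realE:
  assumes "ruin_time p Y U s x L \<omega> \<le> ereal t"
  obtains \<rho> where "ruin_time p Y U s x L \<omega> = ereal \<rho>" "s \<le> \<rho>" "\<rho> \<le> t"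
  using assms ruin_time_ge_start[of s p Y U x L \<omega>]
  by (cases "ruin_time p Y U s x L \<omega>") auto

lemma negative_wealth_near_ruin:
  assumes "ruin_time p Y U s x L \<omega> = ereal \<rho>" "\<rho> < r"
  obtains u where "\<rho> \<le> u" "u < r" "s \<le> u" "wealth p Y U s x L u \<omega> < 0"
proof -
  have "ruin_time p Y U s x L \<omega> < ereal r" using assms by simp
  then obtain u where u: "s \<le> u" "wealth p Y U s x L u \<omega> < 0" "u < r"
    unfolding ruin_time_def Inf_less_iff by auto
  moreover have "\<rho> \<le> u" using ruin_time_le[OF u(1,2)] assms(1) by simp
  ultimately show ?thesis using that by blast
qed

text \<open>
  The conditions of \<open>admissible\<close> at a single sample point \<open>\<omega>\<close>, so that strategies can be compared path by
  path.
\<close>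

locale admissible_path = dividend_path s L \<omega> + claims_path Y U s \<omega>
  for s :: real and L :: "real \<Rightarrow> 'a \<Rightarrow> real" and \<omega> :: 'a and Y U +
  fixes T p x :: real
  assumes horizon: "s \<le> T" and premium: "0 < p" and initial: "0 \<le> x"
    and after_horizon: "\<And>t. T < t \<Longrightarrow> L t \<omega> = right_lim L T \<omega>"
    and solvent: "\<And>t. s \<le> t \<Longrightarrow> t \<le> T \<Longrightarrow> ereal t < ruin_time p Y U s x L \<omega> \<Longrightarrow>
      right_lim L t \<omega> \<le> x + p * (t - s) - claims t"
    and stopped: "\<And>t. s \<le> t \<Longrightarrow> t \<le> T \<Longrightarrow> ruin_time p Y U s x L \<omega> \<le> ereal t \<Longrightarrow>
      right_lim L t \<omega> = L (real_of_ereal (ruin_time p Y U s x L \<omega>)) \<omega>"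
begin

lemma constant_after_ruin:
  assumes "ruin_time p Y U s x L \<omega> = ereal \<rho>" "\<rho> \<le> T" "\<rho> \<le> t"
  shows "L t \<omega> = L \<rho> \<omega>"
proof -
  have \<rho>: "s \<le> \<rho>" using ruin_time_ge_start[of s p Y U x L \<omega>] assms(1) by simp
  have frozen: "right_lim L r \<omega> = L \<rho> \<omega>" if "\<rho> \<le> r" "r \<le> T" for r
    using stopped[of r] that \<rho> assms(1) by simp
  show ?thesis
  proof (cases "t \<le> T")
    case True
    then show ?thesis
      using right_lim_ge[of t] frozen[of t] le[of \<rho> t] \<rho> assms by simp
  qed (use after_horizon frozen[of T] assms in auto)
qed

text \<open>
  If ruin occurred at time \<open>s\<close>, then no dividends could ever be paid, and the wealth would not fall below
  \<open>x \<ge> 0\<close> before the first claim, which comes after \<open>s\<close>.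
\<close>

lemma start_less_ruin_time: "ereal s < ruin_time p Y U s x L \<omega>"
proof (rule ccontr)
  assume "\<not> ?thesis"
  then have ruin: "ruin_time p Y U s x L \<omega> = ereal s"
    using ruin_time_ge_start[of s p Y U x L \<omega>] by simp
  obtain b where b: "s < b" "\<And>r. s \<le> r \<Longrightarrow> r < b \<Longrightarrow> claims r = claims s"
    using claims_right_constant[of s] by blast
  obtain u where u: "s \<le> u" "u < b" "wealth p Y U s x L u \<omega> < 0"
    using negative_wealth_near_ruin[OF ruin b(1)] by blast
  have "L u \<omega> = 0"
    using constant_after_ruin[OF ruin horizon u(1)] start by simp
  moreover have "0 \<le> p * (u - s)" using premium u(1) by simp
  ultimately show False
    using u initial b(2)[OF u(1,2)] by (simp add: wealth_def claims_start)
qed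

lemma paid_le: "right_lim L T \<omega> \<le> x + p * (T - s)"
proof (cases "ereal T < ruin_time p Y U s x L \<omega>")
  case True
  then show ?thesis using solvent[OF horizon] claims_nonneg[of T] by simp
next
  case False
  then have "ruin_time p Y U s x L \<omega> \<le> ereal T" by simp
  then obtain \<rho> where \<rho>: "ruin_time p Y U s x L \<omega> = ereal \<rho>" "s \<le> \<rho>" "\<rho> \<le> T"
    by (rule ruin_time_realE)
  have "s < \<rho>" using start_less_ruin_time \<rho> by simp
  have bound: "L t \<omega> \<le> x + p * (T - s)" if "s \<le> t" "t < \<rho>" for t
  proof -
    have "p * (t - s) \<le> p * (T - s)" using premium that \<rho> by simp
    then show ?thesis
      using that \<rho> solvent[of t] right_lim_ge[of t] claims_nonneg[of t] by simp
  qed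
  have "L \<rho> \<omega> \<le> x + p * (T - s)"
  proof (rule tendsto_upperbound)
    show "((\<lambda>r. L r \<omega>) \<longlongrightarrow> L \<rho> \<omega>) (at_left \<rho>)"
      using left_cont[OF \<open>s < \<rho>\<close>] by (simp add: continuous_within)
    show "\<forall>\<^sub>F r in at_left \<rho>. L r \<omega> \<le> x + p * (T - s)"
      unfolding eventually_at_left_field using \<open>s < \<rho>\<close> by (intro exI[of _ s]) (auto intro: bound)
  qed simp
  then show ?thesis
    using stopped[OF horizon] \<rho> by simp
qed

text \<open>
  The measure \<open>dL\<close> does not charge the time between ruin and the horizon.
\<close>

lemma discounted_dividends_until_horizon:
  "discounted_dividends T p c Y U s x L \<omega> =
    (LINT t:{s..T}|interval_measure (\<lambda>t. if t < s then 0 else right_lim L t \<omega>). exp (- c * (t - s)))"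
proof (cases "ereal T < ruin_time p Y U s x L \<omega>")
  case True
  then have "min (ruin_time p Y U s x L \<omega>) (ereal T) = ereal T" by simp
  then show ?thesis by (simp add: discounted_dividends_def)
next
  case False
  then have "ruin_time p Y U s x L \<omega> \<le> ereal T" by simp
  then obtain \<rho> where \<rho>: "ruin_time p Y U s x L \<omega> = ereal \<rho>" "s \<le> \<rho>" "\<rho> \<le> T"
    by (rule ruin_time_realE)
  let ?\<mu> = "interval_measure (\<lambda>t. if t < s then 0 else right_lim L t \<omega>)"
  have "right_lim L T \<omega> = right_lim L \<rho> \<omega>"
    using \<rho> stopped[of \<rho>] stopped[OF horizon] by simp
  moreover have "emeasure ?\<mu> {\<rho><..T} =
      ennreal ((if T < s then 0 else right_lim L T \<omega>) - (if \<rho> < s then 0 else right_lim L \<rho> \<omega>))"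
    by (rule emeasure_interval_measure_Ioc[OF \<open>\<rho> \<le> T\<close>])
       (rule right_lim_extension_mono right_lim_extension_right_continuous, assumption?)+
  ultimately have "emeasure ?\<mu> {\<rho><..T} = 0"
    using \<rho> horizon by simp
  then have "AE t in ?\<mu>. t \<notin> {\<rho><..T}"
    by (intro AE_not_in null_setsI) simp_all
  then have "AE t in ?\<mu>. indicator {s..T} t *\<^sub>R exp (- c * (t - s)) =
      indicator {s..\<rho>} t *\<^sub>R exp (- c * (t - s))"
    by eventually_elim (use \<rho> in \<open>auto simp: indicator_def\<close>)
  then have "(LINT t:{s..T}|?\<mu>. exp (- c * (t - s))) = (LINT t:{s..\<rho>}|?\<mu>. exp (- c * (t - s)))"
    unfolding set_lebesgue_integral_def
    by (intro integral_cong_AE) simp_all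
  then show ?thesis
    using \<rho> by (simp add: discounted_dividends_def min_absorb1)
qed

lemma discounted_dividends_eq:
  assumes "0 < c"
  shows "discounted_dividends T p c Y U s x L \<omega> = exp (- c * (T - s)) * right_lim L T \<omega> +
    (LINT u:{s..T}|lborel. c * exp (- c * (u - s)) * right_lim L u \<omega>)"
proof -
  have "discounted_dividends T p c Y U s x L \<omega> =
      exp (- c * (T - s)) * (if T < s then 0 else right_lim L T \<omega>) +
      (LINT u:{s..T}|lborel. c * exp (- c * (u - s)) * (if u < s then 0 else right_lim L u \<omega>))"
    unfolding discounted_dividends_until_horizon
    by (rule integral_discount_interval_measure[OF right_lim_extension_mono
        right_lim_extension_right_continuous _ horizon assms]) auto
  also have "(LINT u:{s..T}|lborel. c * exp (- c * (u - s)) * (if u < s then 0 else right_lim L u \<omega>)) =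
      (LINT u:{s..T}|lborel. c * exp (- c * (u - s)) * right_lim L u \<omega>)"
    by (intro set_lebesgue_integral_cong) auto
  finally show ?thesis using horizon by simp
qed

end

section \<open>Comparing discounted payoffs\<close>

lemma (in dividend_path) set_integrable_discounted_right_lim:
  assumes "0 < c"
  shows "set_integrable lborel {s..T} (\<lambda>u. c * exp (- c * (u - s)) * right_lim L u \<omega>)"
proof -
  have "set_integrable lborel {s..T}
      (\<lambda>u. c * exp (- c * (u - s)) * (if u < s then 0 else right_lim L u \<omega>))"
  proof (rule set_integrable_discounted[OF right_lim_extension_mono _ assms])
    show "0 \<le> (if u < s then 0 else right_lim L u \<omega>)" for u
      using right_lim_ge[of u] nonneg[of u] by auto
  qed
  then show ?thesis
    by (rule set_integrable_cong[THEN iffD1, rotated -1]) auto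
qed

lemma discounted_constant:
  fixes c :: real
  assumes "0 < c" "s \<le> T"
  shows "set_integrable lborel {s..T} (\<lambda>u. c * exp (- c * (u - s)) * K)"
    and "exp (- c * (T - s)) * K + (LINT u:{s..T}|lborel. c * exp (- c * (u - s)) * K) = K"
proof -
  have "has_bochner_integral lborel (\<lambda>u. (c * exp (- c * (u - s)) * K) * indicator {s..T} u)
      (- exp (- c * (T - s)) * K - (- exp (- c * (s - s)) * K))"
  proof (rule has_bochner_integral_FTC_Icc_real)
    show "DERIV (\<lambda>u. - exp (- c * (u - s)) * K) u :> c * exp (- c * (u - s)) * K" for u
      by (auto intro!: derivative_eq_intros)
    show "isCont (\<lambda>u. c * exp (- c * (u - s)) * K) u" for u
      by (intro continuous_intros)
  qed fact
  then show "set_integrable lborel {s..T} (\<lambda>u. c * exp (- c * (u - s)) * K)"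
    and "exp (- c * (T - s)) * K + (LINT u:{s..T}|lborel. c * exp (- c * (u - s)) * K) = K"
    by (auto simp: set_integrable_def set_lebesgue_integral_def has_bochner_integral_iff mult.commute
        algebra_simps)
qed

text \<open>
  Integration by parts gives \<open>L\<^sub>t\<^sub>+\<close> nonnegative weights of total mass 1. The lemma is used with
  positive \<open>d\<close> for \<open>withhold\<close> and with negative \<open>d\<close> for \<open>add_lump_sum\<close>.
\<close>

lemma discounted_dividends_mono:
  assumes "admissible_path s L \<omega> Y U T p x" "admissible_path s L' \<omega> Y U T p x'" and "0 < c"
    and le: "\<And>t. s \<le> t \<Longrightarrow> t \<le> T \<Longrightarrow> right_lim L t \<omega> \<le> right_lim L' t \<omega> + d"
  shows "discounted_dividends T p c Y U s x L \<omega> \<le> discounted_dividends T p c Y U s x' L' \<omega> + d"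
proof -
  interpret L: admissible_path s L \<omega> Y U T p x by fact
  interpret L': admissible_path s L' \<omega> Y U T p x' by fact
  let ?e = "\<lambda>u. exp (- c * (u - s))"
  have "?e T * right_lim L T \<omega> \<le> ?e T * right_lim L' T \<omega> + ?e T * d"
    using le[of T] L.horizon by (simp flip: distrib_left)
  moreover have "(LINT u:{s..T}|lborel. c * ?e u * right_lim L u \<omega>) \<le>
      (LINT u:{s..T}|lborel. c * ?e u * right_lim L' u \<omega> + c * ?e u * d)"
    using assms L.horizon
    by (intro set_integral_mono set_integral_add L.set_integrable_discounted_right_lim
        L'.set_integrable_discounted_right_lim discounted_constant) (auto simp flip: distrib_left)
  moreover have "\<dots> = (LINT u:{s..T}|lborel. c * ?e u * right_lim L' u \<omega>) +
      (LINT u:{s..T}|lborel. c * ?e u * d)"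
    using assms L.horizon
    by (intro set_integral_add L'.set_integrable_discounted_right_lim discounted_constant)
  ultimately show ?thesis
    using discounted_constant(2)[OF \<open>0 < c\<close> L.horizon, of d]
    by (simp add: L.discounted_dividends_eq[OF \<open>0 < c\<close>] L'.discounted_dividends_eq[OF \<open>0 < c\<close>])
qed

lemma (in admissible_path) discounted_dividends_bounds:
  assumes "0 < c"
  shows "0 \<le> discounted_dividends T p c Y U s x L \<omega>"
    and "discounted_dividends T p c Y U s x L \<omega> \<le> x + p * (T - s)"
proof -
  let ?e = "\<lambda>u. exp (- c * (u - s))"
  have nonneg': "0 \<le> right_lim L u \<omega>" if "s \<le> u" for u
    using right_lim_ge[OF that] nonneg[OF that] by simp
  then have "0 \<le> (LINT u:{s..T}|lborel. c * ?e u * right_lim L u \<omega>)"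
    unfolding set_lebesgue_integral_def using assms by (auto simp: indicator_def intro!: integral_nonneg_AE)
  then show "0 \<le> discounted_dividends T p c Y U s x L \<omega>"
    using nonneg'[OF horizon] by (simp add: discounted_dividends_eq[OF assms])
  have "(LINT u:{s..T}|lborel. c * ?e u * right_lim L u \<omega>) \<le>
      (LINT u:{s..T}|lborel. c * ?e u * right_lim L T \<omega>)"
    using assms horizon
    by (intro set_integral_mono set_integrable_discounted_right_lim discounted_constant)
       (auto intro!: mult_left_mono right_lim_mono)
  then have "discounted_dividends T p c Y U s x L \<omega> \<le> right_lim L T \<omega>"
    using discounted_constant(2)[OF assms horizon, of "right_lim L T \<omega>"]
    by (simp add: discounted_dividends_eq[OF assms])
  also have "\<dots> \<le> x + p * (T - s)" by (rule paid_le)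
  finally show "discounted_dividends T p c Y U s x L \<omega> \<le> x + p * (T - s)" .
qed

section \<open>An additional initial lump sum\<close>

text \<open>
  A lump sum paid at time \<open>s\<close> enters a left-continuous path only after \<open>s\<close>.
\<close>

definition add_lump_sum :: "real \<Rightarrow> real \<Rightarrow> (real \<Rightarrow> 'a \<Rightarrow> real) \<Rightarrow> real \<Rightarrow> 'a \<Rightarrow> real" where
  "add_lump_sum s d L t \<omega> = (if s < t then L t \<omega> + d else 0)"

lemma (in dividend_path)
  assumes "0 \<le> d"
  shows dividend_path_add_lump_sum: "dividend_path s (add_lump_sum s d L) \<omega>"
    and right_lim_add_lump_sum:
      "s \<le> t \<Longrightarrow> right_lim (add_lump_sum s d L) t \<omega> = right_lim L t \<omega> + d"
proof -
  show path: "dividend_path s (add_lump_sum s d L) \<omega>"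
  proof
    show "mono_on {s..} (\<lambda>t. add_lump_sum s d L t \<omega>)"
      using assms nonneg by (auto simp: mono_on_def add_lump_sum_def intro!: le add_nonneg_nonneg)
    fix t assume "s < t"
    have "((\<lambda>r. L r \<omega> + d) \<longlongrightarrow> L t \<omega> + d) (at_left t)"
      using left_cont[OF \<open>s < t\<close>] by (intro tendsto_add tendsto_const) (simp add: continuous_within)
    moreover have "\<forall>\<^sub>F r in at_left t. L r \<omega> + d = add_lump_sum s d L r \<omega>"
      unfolding eventually_at_left_field using \<open>s < t\<close>
      by (intro exI[of _ s]) (auto simp: add_lump_sum_def)
    ultimately show "continuous (at_left t) (\<lambda>r. add_lump_sum s d L r \<omega>)"
      using \<open>s < t\<close> by (auto simp: continuous_within add_lump_sum_def elim: Lim_transform_eventually)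
  qed (simp add: add_lump_sum_def)
  assume "s \<le> t"
  have "((\<lambda>r. L r \<omega> + d) \<longlongrightarrow> right_lim L t \<omega> + d) (at_right t)"
    by (intro tendsto_add tendsto_const right_lim_tendsto \<open>s \<le> t\<close>)
  moreover have "\<forall>\<^sub>F r in at_right t. L r \<omega> + d = add_lump_sum s d L r \<omega>"
    unfolding eventually_at_right_field using \<open>s \<le> t\<close>
    by (intro exI[of _ "t + 1"]) (auto simp: add_lump_sum_def)
  ultimately have "((\<lambda>r. add_lump_sum s d L r \<omega>) \<longlongrightarrow> right_lim L t \<omega> + d) (at_right t)"
    by (rule Lim_transform_eventually)
  then show "right_lim (add_lump_sum s d L) t \<omega> = right_lim L t \<omega> + d"
    unfolding right_lim_def by (intro tendsto_Lim) auto
qed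

text \<open>
  The wealth changes only at time \<open>s\<close>, where it is nonnegative either way; so the ruin time is the same.
  As it lies after \<open>s\<close>, the lump sum is contained in the dividends paid up to ruin.
\<close>

lemma (in admissible_path) admissible_path_add_lump_sum:
  assumes "0 \<le> d"
  shows "admissible_path s (add_lump_sum s d L) \<omega> Y U T p (x + d)"
proof -
  interpret L': dividend_path s "add_lump_sum s d L" \<omega>
    by (rule dividend_path_add_lump_sum[OF assms])
  have "wealth p Y U s (x + d) (add_lump_sum s d L) t \<omega> < 0 \<longleftrightarrow> wealth p Y U s x L t \<omega> < 0"
    if "s \<le> t" for t
    using that assms initial claims_start start by (cases "s = t") (auto simp: wealth_def add_lump_sum_def)
  then have ruin: "ruin_time p Y U s (x + d) (add_lump_sum s d L) \<omega> = ruin_time p Y U s x L \<omega>"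
    unfolding ruin_time_def by (intro arg_cong[where f=Inf] arg_cong2[where f=image]) auto
  show ?thesis
  proof
    fix t assume "T < t"
    then show "add_lump_sum s d L t \<omega> = right_lim (add_lump_sum s d L) T \<omega>"
      using horizon after_horizon by (simp add: right_lim_add_lump_sum[OF assms] add_lump_sum_def)
  next
    fix t assume "s \<le> t" "t \<le> T" "ereal t < ruin_time p Y U s (x + d) (add_lump_sum s d L) \<omega>"
    then show "right_lim (add_lump_sum s d L) t \<omega> \<le> x + d + p * (t - s) - claims t"
      using solvent[of t] by (simp add: ruin right_lim_add_lump_sum[OF assms])
  next
    fix t assume t: "s \<le> t" "t \<le> T" "ruin_time p Y U s (x + d) (add_lump_sum s d L) \<omega> \<le> ereal t"
    then obtain \<rho> where \<rho>: "ruin_time p Y U s x L \<omega> = ereal \<rho>"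
      unfolding ruin using ruin_time_realE by metis
    then have "s < \<rho>" using start_less_ruin_time by simp
    then show "right_lim (add_lump_sum s d L) t \<omega> =
        add_lump_sum s d L (real_of_ereal (ruin_time p Y U s (x + d) (add_lump_sum s d L) \<omega>)) \<omega>"
      using t stopped[of t] \<rho>
      by (simp add: ruin right_lim_add_lump_sum[OF assms] add_lump_sum_def)
  qed (use horizon premium initial assms in auto)
qed

section \<open>Withholding the first dividends\<close>

text \<open>
  Testing rational times only keeps the condition measurable. It loses nothing, since the wealth without
  dividends is right-continuous, except at \<open>T\<close>, where the later times are out of reach; therefore \<open>T\<close>
  is tested as well. Using \<open>total_claims\<close> instead of \<open>total_claims_from\<close> makes the condition adapted for
  every sample point, not just almost surely.
\<close>

definition survives_unpaid ::
  "(nat \<Rightarrow> 'a \<Rightarrow> real) \<Rightarrow> (nat \<Rightarrow> 'a \<Rightarrow> real) \<Rightarrow> real \<Rightarrow> real \<Rightarrow> real \<Rightarrow> real \<Rightarrow> real \<Rightarrow> 'a \<Rightarrow> bool" where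
  "survives_unpaid Y U p s T x q \<omega> \<longleftrightarrow> (\<forall>r\<in>insert T \<rat>. s \<le> r \<and> r \<le> min q T \<longrightarrow>
     0 \<le> x + p * (r - s) - (total_claims Y U r \<omega> - total_claims Y U s \<omega>))"

definition excess_while_solvent ::
  "(nat \<Rightarrow> 'a \<Rightarrow> real) \<Rightarrow> (nat \<Rightarrow> 'a \<Rightarrow> real) \<Rightarrow> real \<Rightarrow> real \<Rightarrow> real \<Rightarrow> real \<Rightarrow> real \<Rightarrow>
   (real \<Rightarrow> 'a \<Rightarrow> real) \<Rightarrow> real \<Rightarrow> 'a \<Rightarrow> real" where
  "excess_while_solvent Y U p s T x d L q \<omega> =
     (if survives_unpaid Y U p s T x q \<omega> then max 0 (L q \<omega> - d) else 0)"

text \<open>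
  The payments \<open>(L - d)\<^sup>+\<close> stop once the wealth without dividends has been ruined. Freezing the
  strategy at that time would call for the measurability of a stopped process; the supremum over earlier
  rational times has the same effect and is nondecreasing, left-continuous and predictable by its form.
\<close>

definition withhold ::
  "(nat \<Rightarrow> 'a \<Rightarrow> real) \<Rightarrow> (nat \<Rightarrow> 'a \<Rightarrow> real) \<Rightarrow> real \<Rightarrow> real \<Rightarrow> real \<Rightarrow> real \<Rightarrow> real \<Rightarrow>
   (real \<Rightarrow> 'a \<Rightarrow> real) \<Rightarrow> real \<Rightarrow> 'a \<Rightarrow> real" where
  "withhold Y U p s T x d L t \<omega> =
     Sup (insert 0 ((\<lambda>q. excess_while_solvent Y U p s T x d L q \<omega>) ` {q \<in> \<rat>. s < q \<and> q < t}))"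

lemma excess_le: "excess_while_solvent Y U p s T x d L q \<omega> \<le> max 0 (L q \<omega> - d)"
  by (simp add: excess_while_solvent_def)

context dividend_path
begin

context
  fixes Y U :: "nat \<Rightarrow> 'a \<Rightarrow> real" and p T x d :: real
begin

abbreviation "excess q \<equiv> excess_while_solvent Y U p s T x d L q \<omega>"
abbreviation "withheld t \<equiv> withhold Y U p s T x d L t \<omega>"

lemma excess_bdd_above: "bdd_above (insert 0 (excess ` {q \<in> \<rat>. s < q \<and> q < t}))"
proof (rule bdd_aboveI)
  fix y assume "y \<in> insert 0 (excess ` {q \<in> \<rat>. s < q \<and> q < t})"
  then consider "y = 0" | q where "s < q" "q < t" "y = excess q" by auto
  then show "y \<le> max 0 (L t \<omega> - d)"
  proof cases
    case 2
    then have "y \<le> max 0 (L q \<omega> - d)" using excess_le by simp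
    also have "\<dots> \<le> max 0 (L t \<omega> - d)" using 2 le[of q t] by auto
    finally show ?thesis .
  qed simp
qed

lemma excess_le_withhold: "q \<in> \<rat> \<Longrightarrow> s < q \<Longrightarrow> q < t \<Longrightarrow> excess q \<le> withheld t"
  unfolding withhold_def by (intro cSup_upper excess_bdd_above) auto

lemma withhold_nonneg: "0 \<le> withheld t"
  unfolding withhold_def by (intro cSup_upper excess_bdd_above) auto

lemma withhold_least:
  "0 \<le> K \<Longrightarrow> (\<And>q. q \<in> \<rat> \<Longrightarrow> s < q \<Longrightarrow> q < t \<Longrightarrow> excess q \<le> K) \<Longrightarrow> withheld t \<le> K"
  unfolding withhold_def by (intro cSup_least) auto

lemma withhold_le: "s \<le> t \<Longrightarrow> withheld t \<le> max 0 (L t \<omega> - d)"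
proof (intro withhold_least)
  fix q assume "s < q" "q < t"
  then have "L q \<omega> \<le> L t \<omega>" by (intro le) auto
  then show "excess q \<le> max 0 (L t \<omega> - d)"
    by (intro order_trans[OF excess_le]) auto
qed simp

lemma withhold_mono: "t \<le> r \<Longrightarrow> withheld t \<le> withheld r"
  by (intro withhold_least withhold_nonneg excess_le_withhold) auto

lemma less_withholdE:
  assumes "y < withheld t" "0 \<le> y"
  obtains q where "q \<in> \<rat>" "s < q" "q < t" "y < excess q"
proof (rule ccontr)
  assume "\<not> thesis"
  then have "excess q \<le> y" if "q \<in> \<rat>" "s < q" "q < t" for q
    using that(1,2,3) \<open>\<And>q. q \<in> \<rat> \<Longrightarrow> s < q \<Longrightarrow> q < t \<Longrightarrow> y < excess q \<Longrightarrow> thesis\<close> by (auto simp: not_less[symmetric])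
  then have "withheld t \<le> y"
    by (intro withhold_least \<open>0 \<le> y\<close>)
  then show False using \<open>y < withheld t\<close> by simp
qed

lemma dividend_path_withhold: "dividend_path s (withhold Y U p s T x d L) \<omega>"
proof
  show "withheld s = 0"
    by (intro antisym withhold_nonneg withhold_least) auto
  show "mono_on {s..} withheld"
    by (intro mono_onI withhold_mono)
  fix t assume "s < t"
  have "(withheld \<longlongrightarrow> withheld t) (at_left t)"
  proof (rule order_tendstoI)
    fix y assume "y < withheld t"
    show "\<forall>\<^sub>F r in at_left t. y < withheld r"
    proof (cases "0 \<le> y")
      case True
      with \<open>y < withheld t\<close> obtain q where q: "q \<in> \<rat>" "s < q" "q < t" "y < excess q"
        by (rule less_withholdE)
      then show ?thesis
        unfolding eventually_at_left_field
        by (intro exI[of _ q] conjI allI impI less_le_trans[OF q(4) excess_le_withhold])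
    next
      case False
      then show ?thesis
        by (intro always_eventually allI less_le_trans[OF _ withhold_nonneg]) simp
    qed
  next
    fix y assume "withheld t < y"
    then have "withheld r < y" if "r < t" for r
      using withhold_mono[of r t] that by simp
    then show "\<forall>\<^sub>F r in at_left t. withheld r < y"
      unfolding eventually_at_left_field
      by (intro exI[of _ "t - 1"]) auto
  qed
  then show "continuous (at_left t) withheld"
    by (simp add: continuous_within)
qed

text \<open>
  Payments indexed by \<open>q > T\<close> all agree, because \<open>L\<close> is constant after \<open>T\<close> and solvency is tested only up
  to \<open>min q T\<close>.
\<close>

lemma withhold_after_horizon:
  assumes "s \<le> T" and const: "\<And>t. T < t \<Longrightarrow> L t \<omega> = right_lim L T \<omega>" and "T < t"
  shows "withheld t = right_lim (withhold Y U p s T x d L) T \<omega>"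
proof -
  interpret W: dividend_path s "withhold Y U p s T x d L" \<omega>
    by (rule dividend_path_withhold)
  have "withheld t \<le> withheld r" if "T < r" for r
  proof (intro withhold_least withhold_nonneg)
    fix q assume q: "q \<in> \<rat>" "s < q" "q < t"
    show "excess q \<le> withheld r"
    proof (cases "q \<le> T")
      case True
      then show ?thesis using q that by (intro excess_le_withhold) auto
    next
      case False
      obtain q' where q': "q' \<in> \<rat>" "T < q'" "q' < r"
        using Rats_dense_in_real[OF \<open>T < r\<close>] by blast
      have "min q T = T" "min q' T = T" "L q \<omega> = L q' \<omega>"
        using False q' const by auto
      then have "excess q = excess q'"
        by (simp only: excess_while_solvent_def survives_unpaid_def)
      also have "\<dots> \<le> withheld r"
        using q' \<open>s \<le> T\<close> by (intro excess_le_withhold) auto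
      finally show ?thesis .
    qed
  qed
  then show ?thesis
    using W.right_lim_le[OF \<open>s \<le> T\<close> \<open>T < t\<close>] W.right_lim_greatest[OF \<open>s \<le> T\<close>, of "withheld t"]
    by (intro antisym) auto
qed

end

end

lemma (in dividend_path) le_if_le_at_earlier_rationals:
  assumes "s < t" and bound: "\<And>q. q \<in> \<rat> \<Longrightarrow> s < q \<Longrightarrow> q < t \<Longrightarrow> L q \<omega> \<le> B"
  shows "L t \<omega> \<le> B"
proof (rule tendsto_upperbound)
  show "((\<lambda>r. L r \<omega>) \<longlongrightarrow> L t \<omega>) (at_left t)"
    using left_cont[OF \<open>s < t\<close>] by (simp add: continuous_within)
  have "L r \<omega> \<le> B" if "s < r" "r < t" for r
  proof -
    obtain q where q: "q \<in> \<rat>" "r < q" "q < t"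
      using Rats_dense_in_real[OF \<open>r < t\<close>] by blast
    then show ?thesis
      using bound[of q] le[of r q] that by simp
  qed
  then show "\<forall>\<^sub>F r in at_left t. L r \<omega> \<le> B"
    unfolding eventually_at_left_field using \<open>s < t\<close> by (intro exI[of _ s]) auto
qed simp

lemma (in dividend_path) right_lim_le_if_eventually_le:
  assumes "s \<le> t" "t < b" and bound: "\<And>u. t < u \<Longrightarrow> u < b \<Longrightarrow> L u \<omega> \<le> B + p * (u - t)"
  shows "right_lim L t \<omega> \<le> B"
proof (rule tendsto_le)
  show "((\<lambda>u. L u \<omega>) \<longlongrightarrow> right_lim L t \<omega>) (at_right t)"
    by (rule right_lim_tendsto[OF \<open>s \<le> t\<close>])
  have "((\<lambda>u. B + p * (u - t)) \<longlongrightarrow> B + p * (t - t)) (at_right t)"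
    by (intro tendsto_intros)
  then show "((\<lambda>u. B + p * (u - t)) \<longlongrightarrow> B) (at_right t)"
    by simp
  show "\<forall>\<^sub>F u in at_right t. L u \<omega> \<le> B + p * (u - t)"
    unfolding eventually_at_right_field using \<open>t < b\<close> by (intro exI[of _ b]) (auto intro: bound)
qed simp

context claims_path
begin

lemma survives_unpaid_iff:
  "survives_unpaid Y U p s T x q \<omega> \<longleftrightarrow>
    (\<forall>r\<in>insert T \<rat>. s \<le> r \<and> r \<le> min q T \<longrightarrow> 0 \<le> x + p * (r - s) - claims r)"
  by (auto simp: survives_unpaid_def total_claims_from_eq_diff)

lemma not_survives_unpaid:
  assumes "0 < p" "s \<le> r" "r \<le> T" "r \<le> q" "q \<in> \<rat>" "x + p * (r - s) - claims r < 0"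
  shows "\<not> survives_unpaid Y U p s T x q \<omega>"
proof -
  have "\<exists>u\<in>insert T \<rat>. s \<le> u \<and> u \<le> min q T \<and> x + p * (u - s) - claims u < 0"
  proof (cases "r = T \<or> r = q")
    case True
    with assms show ?thesis by (intro bexI[of _ r]) auto
  next
    case False
    then have r: "r < T" "r < q" using assms by auto
    obtain b where b: "r < b" "\<And>u. r \<le> u \<Longrightarrow> u < b \<Longrightarrow> claims u = claims r"
      using claims_right_constant[of r] by blast
    define m where "m = (claims r - x - p * (r - s)) / p"
    have "0 < m" using assms by (simp add: m_def)
    then have "r < min (min b (min T q)) (r + m)"
      using r b by simp
    then obtain u where u: "u \<in> \<rat>" "r < u" "u < min (min b (min T q)) (r + m)"
      using Rats_dense_in_real by blast
    have "p * (u - r) < p * m"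
      using u \<open>0 < p\<close> by (intro mult_strict_left_mono) auto
    then have "p * (u - r) < claims r - x - p * (r - s)"
      using \<open>0 < p\<close> by (simp add: m_def)
    moreover have "claims u = claims r"
      using u b(2)[of u] by simp
    ultimately have "x + p * (u - s) - claims u < 0"
      by (simp add: algebra_simps)
    then show ?thesis
      using u assms(2) by (intro bexI[of _ u]) auto
  qed
  then show ?thesis
    unfolding survives_unpaid_iff by (meson not_le)
qed

end

context admissible_path
begin

context
  fixes x' d :: real
  assumes x_eq: "x = x' + d" and x'_nonneg: "0 \<le> x'"
begin

abbreviation "L' \<equiv> withhold Y U p s T x' d L"
abbreviation "unpaid t \<equiv> x' + p * (t - s) - claims t"

interpretation W: dividend_path s L' \<omega>
  by (rule dividend_path_withhold)

lemma excess_le_withheld: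
  assumes "q \<in> \<rat>" "s < q" "q < t" "\<And>r. s \<le> r \<Longrightarrow> r \<le> q \<Longrightarrow> r \<le> T \<Longrightarrow> 0 \<le> unpaid r"
  shows "L q \<omega> - d \<le> L' t \<omega>"
proof -
  have "survives_unpaid Y U p s T x' q \<omega>"
    unfolding survives_unpaid_iff using assms(4) by auto
  then have "L q \<omega> - d \<le> excess_while_solvent Y U p s T x' d L q \<omega>"
    by (simp add: excess_while_solvent_def)
  also have "\<dots> \<le> L' t \<omega>"
    using assms by (intro excess_le_withhold)
  finally show ?thesis .
qed

lemma excess_le_withheld_at:
  assumes "s < t" "\<And>r. s \<le> r \<Longrightarrow> r < t \<Longrightarrow> r \<le> T \<Longrightarrow> 0 \<le> unpaid r"
  shows "L t \<omega> - d \<le> L' t \<omega>"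
proof -
  have "L t \<omega> \<le> L' t \<omega> + d"
  proof (rule le_if_le_at_earlier_rationals[OF \<open>s < t\<close>])
    fix q assume "q \<in> \<rat>" "s < q" "q < t"
    then show "L q \<omega> \<le> L' t \<omega> + d"
      using excess_le_withheld[of q t] assms(2) by simp
  qed
  then show ?thesis by simp
qed

text \<open>
  While the wealth without dividends is nonnegative, \<open>withhold\<close> can be ruined only by its own payments;
  but then it has paid at most \<open>L - d\<close> and its wealth is at least that of \<open>L\<close>.
\<close>

lemma negative_wealth_if_withheld_negative:
  assumes "s \<le> u" "wealth p Y U s x' L' u \<omega> < 0" "0 \<le> unpaid u"
  shows "wealth p Y U s x L u \<omega> < 0"
proof -
  have "0 < L' u \<omega>" "unpaid u < L' u \<omega>"
    using assms by (auto simp: wealth_def)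
  then have "L' u \<omega> \<le> L u \<omega> - d"
    using withhold_le[OF \<open>s \<le> u\<close>, of Y U p T x' d] by (auto simp: max_def split: if_splits)
  then show ?thesis
    using assms by (simp add: wealth_def x_eq)
qed

text \<open>
  Solvency before ruin holds by right-continuity of the claims. For the condition that nothing is paid
  after ruin, there are two reasons why ruin can have occurred: either the wealth without dividends is
  ruined, and then the payments stop by definition, or \<open>L\<close> itself is ruined, and then \<open>L\<close> is
  constant and \<open>withhold\<close> with it.
\<close>

lemma admissible_path_withhold: "admissible_path s L' \<omega> Y U T p x'"
proof
  show "L' t \<omega> = right_lim L' T \<omega>" if "T < t" for t
    by (rule withhold_after_horizon[OF horizon after_horizon that])
next
  fix t assume t: "s \<le> t" "t \<le> T" "ereal t < ruin_time p Y U s x' L' \<omega>"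
  obtain z where z: "ereal t < ereal z" "ereal z < ruin_time p Y U s x' L' \<omega>"
    using ereal_dense2[OF t(3)] by blast
  obtain b where b: "t < b" "\<And>u. t \<le> u \<Longrightarrow> u < b \<Longrightarrow> claims u = claims t"
    using claims_right_constant[of t] by blast
  show "right_lim L' t \<omega> \<le> unpaid t"
  proof (rule W.right_lim_le_if_eventually_le[OF \<open>s \<le> t\<close>])
    show "t < min z b" using z b by simp
    fix u assume u: "t < u" "u < min z b"
    then have "ereal u < ruin_time p Y U s x' L' \<omega>"
      using z by (auto intro: less_trans[of _ "ereal z"])
    then have "0 \<le> wealth p Y U s x' L' u \<omega>"
      using u t by (intro wealth_nonneg_before_ruin) auto
    then show "L' u \<omega> \<le> unpaid t + p * (u - t)"
      using b(2)[of u] u by (simp add: wealth_def algebra_simps)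
  qed
next
  fix t assume t: "s \<le> t" "t \<le> T" "ruin_time p Y U s x' L' \<omega> \<le> ereal t"
  from t(3) obtain \<rho>' where \<rho>': "ruin_time p Y U s x' L' \<omega> = ereal \<rho>'" "s \<le> \<rho>'" "\<rho>' \<le> t"
    by (rule ruin_time_realE)
  have "L' (t + 1) \<omega> \<le> L' \<rho>' \<omega>"
  proof (intro withhold_least withhold_nonneg)
    fix q assume q: "q \<in> \<rat>" "s < q" "q < t + 1"
    show "excess_while_solvent Y U p s T x' d L q \<omega> \<le> L' \<rho>' \<omega>"
    proof (cases "q < \<rho>'")
      case True
      with q show ?thesis by (intro excess_le_withhold)
    next
      case False
      show ?thesis
      proof (cases "\<exists>r. s \<le> r \<and> r \<le> \<rho>' \<and> unpaid r < 0")
        case True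
        then obtain r where r: "s \<le> r" "r \<le> \<rho>'" "unpaid r < 0" by blast
        have "\<not> survives_unpaid Y U p s T x' q \<omega>"
          using r q False \<rho>' t by (intro not_survives_unpaid[of p r] premium) auto
        then have "excess_while_solvent Y U p s T x' d L q \<omega> = 0"
          by (simp add: excess_while_solvent_def)
        then show ?thesis
          using withhold_nonneg by simp
      next
        case no_ruin: False
        have "ruin_time p Y U s x L \<omega> \<le> ereal \<rho>'"
        proof (rule ccontr)
          assume "\<not> ?thesis"
          then obtain z where z: "ereal \<rho>' < ereal z" "ereal z < ruin_time p Y U s x L \<omega>"
            using ereal_dense2 by (metis not_le)
          obtain b where b: "\<rho>' < b" "\<And>u. \<rho>' \<le> u \<Longrightarrow> u < b \<Longrightarrow> claims u = claims \<rho>'"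
            using claims_right_constant[of \<rho>'] by blast
          have "\<rho>' < min z b" using z b by simp
          from negative_wealth_near_ruin[OF \<rho>'(1) this]
          obtain u where u: "\<rho>' \<le> u" "u < min z b" "s \<le> u" "wealth p Y U s x' L' u \<omega> < 0"
            by blast
          have "0 \<le> unpaid \<rho>'" using no_ruin \<rho>' by auto
          also have "\<dots> \<le> unpaid u"
            using b(2)[of u] u premium by simp
          finally have "ruin_time p Y U s x L \<omega> \<le> ereal u"
            using u by (intro ruin_time_le negative_wealth_if_withheld_negative)
          then have "ereal z \<le> ereal u"
            using z(2) by (meson less_le_trans order.strict_implies_order)
          then show False using u by simp
        qed
        then obtain \<rho> where \<rho>: "ruin_time p Y U s x L \<omega> = ereal \<rho>" "s \<le> \<rho>" "\<rho> \<le> \<rho>'"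
          by (rule ruin_time_realE)
        have "s < \<rho>'" using start_less_ruin_time \<rho> by simp
        have "L q \<omega> = L \<rho> \<omega>" "L \<rho>' \<omega> = L \<rho> \<omega>"
          using False \<rho> \<rho>' t by (intro constant_after_ruin[OF \<rho>(1)]; simp)+
        then have "excess_while_solvent Y U p s T x' d L q \<omega> \<le> max 0 (L \<rho>' \<omega> - d)"
          using excess_le[of Y U p s T x' d L q \<omega>] by simp
        also have "\<dots> \<le> L' \<rho>' \<omega>"
        proof (rule max.boundedI)
          show "L \<rho>' \<omega> - d \<le> L' \<rho>' \<omega>"
            using no_ruin by (intro excess_le_withheld_at \<open>s < \<rho>'\<close>) (auto simp: not_less)
        qed (rule withhold_nonneg)
        finally show ?thesis .
      qed
    qed
  qed
  moreover have "right_lim L' t \<omega> \<le> L' (t + 1) \<omega>"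
    using t by (intro W.right_lim_le) auto
  moreover have "L' \<rho>' \<omega> \<le> L' t \<omega>" "L' t \<omega> \<le> right_lim L' t \<omega>"
    using t \<rho>' W.le W.right_lim_ge by auto
  ultimately show "right_lim L' t \<omega> = L' (real_of_ereal (ruin_time p Y U s x' L' \<omega>)) \<omega>"
    by (simp add: \<rho>')
qed (use horizon premium x'_nonneg in auto)

text \<open>
  As long as the wealth without dividends is not ruined before \<open>L\<close> is, \<open>withhold\<close> pays \<open>(L - d)\<^sup>+\<close> up to the
  ruin of \<open>L\<close>, and after it \<open>L\<close> is constant.
\<close>

lemma right_lim_le_withheld:
  assumes ruin: "\<And>r. s \<le> r \<Longrightarrow> r \<le> T \<Longrightarrow> unpaid r < 0 \<Longrightarrow> ruin_time p Y U s x L \<omega> \<le> ereal r"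
    and t: "s \<le> t" "t \<le> T"
  shows "right_lim L t \<omega> \<le> right_lim L' t \<omega> + d"
proof (cases "ereal t < ruin_time p Y U s x L \<omega>")
  case True
  have solvent: "0 \<le> unpaid r" if "s \<le> r" "r \<le> T" "ereal r < ruin_time p Y U s x L \<omega>" for r
    using ruin[OF that(1,2)] that(3) by (auto simp flip: not_less)
  have "right_lim L t \<omega> - d \<le> right_lim L' t \<omega>"
  proof (rule W.right_lim_greatest[OF \<open>s \<le> t\<close>])
    fix u assume "t < u"
    obtain z where z: "ereal t < ereal z" "ereal z < ruin_time p Y U s x L \<omega>"
      using ereal_dense2[OF True] by blast
    \<comment> \<open>For \<open>t < T\<close>, solvency until \<open>q\<close> requires \<open>q\<close> to lie before the ruin of \<open>L\<close>. For \<open>t = T\<close>, solvency is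
      tested only up to \<open>T\<close>, so that any \<open>q\<close> after \<open>T\<close> will do.\<close>
    have "t < (if t < T then min u z else u)"
      using \<open>t < u\<close> z by simp
    then obtain q where q: "q \<in> \<rat>" "t < q" "q < (if t < T then min u z else u)"
      using Rats_dense_in_real by blast
    have "right_lim L t \<omega> - d \<le> L q \<omega> - d"
      using q t by (intro diff_right_mono right_lim_le) auto
    also have "\<dots> \<le> L' u \<omega>"
    proof (rule excess_le_withheld[OF q(1)])
      show "s < q" using q t by simp
      show "q < u" using q by (auto split: if_splits)
      fix r assume r: "s \<le> r" "r \<le> q" "r \<le> T"
      have "r \<le> z"
        using r q z t by (cases "t < T") auto
      then show "0 \<le> unpaid r"
        using r z(2) by (intro solvent) (auto intro: le_less_trans[of _ "ereal z"])
    qed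
    finally show "right_lim L t \<omega> - d \<le> L' u \<omega>" .
  qed
  then show ?thesis by simp
next
  case False
  then have "ruin_time p Y U s x L \<omega> \<le> ereal t" by simp
  then obtain \<rho> where \<rho>: "ruin_time p Y U s x L \<omega> = ereal \<rho>" "s \<le> \<rho>" "\<rho> \<le> t"
    by (rule ruin_time_realE)
  have "s < \<rho>" using start_less_ruin_time \<rho> by simp
  have "right_lim L t \<omega> = L \<rho> \<omega>"
    using stopped[OF t] \<rho> by simp
  moreover have "L \<rho> \<omega> - d \<le> L' \<rho> \<omega>"
  proof (rule excess_le_withheld_at[OF \<open>s < \<rho>\<close>])
    fix r assume r: "s \<le> r" "r < \<rho>" "r \<le> T"
    then show "0 \<le> unpaid r"
      using ruin[of r] \<rho>(1) by (auto simp flip: not_less)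
  qed
  moreover have "L' \<rho> \<omega> \<le> right_lim L' t \<omega>"
    using W.le[OF \<rho>(2,3)] W.right_lim_ge[OF t(1)] by simp
  ultimately show ?thesis by simp
qed

text \<open>
  At the claim that ruins the wealth started at \<open>x'\<close> without dividends, the accumulated loss exceeds \<open>x'\<close>.
  If it never lies in the window \<open>{x'..<x' + 2 * d}\<close>, it exceeds even \<open>x' + d\<close>, the initial wealth of \<open>L\<close>,
  so this claim ruins \<open>L\<close>, too. The window has length \<open>2 * d\<close> and not \<open>d\<close> in order to exclude equality,
  where the wealth of \<open>L\<close> could be exactly 0.
\<close>

lemma ruin_if_unpaid_ruined:
  assumes "0 < d" and gap: "\<And>n. 1 \<le> n \<Longrightarrow> s + (\<Sum>k=1..n. wait_from Y s k \<omega>) \<le> T \<Longrightarrow>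
      (\<Sum>k=1..n. claim_from Y U s k \<omega>) - p * (\<Sum>k=1..n. wait_from Y s k \<omega>) \<notin> {x'..<x' + 2 * d}"
    and r: "s \<le> r" "r \<le> T" "unpaid r < 0"
  shows "ruin_time p Y U s x L \<omega> \<le> ereal r"
proof -
  have "0 \<le> p * (r - s)" using premium r by simp
  then have "0 < claims r" using r x'_nonneg by simp
  then obtain n where n: "1 \<le> n" "s < s + (\<Sum>k=1..n. wait_from Y s k \<omega>)"
    "s + (\<Sum>k=1..n. wait_from Y s k \<omega>) \<le> r"
    "claims (s + (\<Sum>k=1..n. wait_from Y s k \<omega>)) = claims r"
    "claims r = (\<Sum>k=1..n. claim_from Y U s k \<omega>)"
    by (rule last_claim_before[OF r(1)])
  define e where "e = (\<Sum>k=1..n. wait_from Y s k \<omega>)"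
  have "p * e \<le> p * (r - s)"
    using n(3) premium by (intro mult_left_mono) (auto simp: e_def)
  then have "x' < claims r - p * e" using r by simp
  moreover have "claims r - p * e \<notin> {x'..<x' + 2 * d}"
    unfolding n(5) e_def using n r by (intro gap) auto
  ultimately have "x' + 2 * d \<le> claims r - p * e" by simp
  then have "wealth p Y U s x L (s + e) \<omega> < 0"
    using n(4)[folded e_def] nonneg[of "s + e"] n(2)[folded e_def] \<open>0 < d\<close>
    by (simp add: wealth_def x_eq)
  then have "ruin_time p Y U s x L \<omega> \<le> ereal (s + e)"
    using n(2) by (intro ruin_time_le) (auto simp: e_def)
  also have "\<dots> \<le> ereal r" using n(3) by (simp add: e_def)
  finally show ?thesis .
qed

end

end

section \<open>Measurability of the claim process\<close>

context
  fixes P :: "'a measure" and Y U :: "nat \<Rightarrow> 'a \<Rightarrow> real"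
  assumes wait_measurable: "\<And>i. 1 \<le> i \<Longrightarrow> Y i \<in> borel_measurable P"
    and claim_measurable: "\<And>i. 1 \<le> i \<Longrightarrow> U i \<in> borel_measurable P"
begin

lemma claim_time_measurable: "claim_time Y n \<in> borel_measurable P"
  unfolding claim_time_def[abs_def] by (intro borel_measurable_sum wait_measurable) auto

lemma claim_count_measurable: "claim_count Y t \<in> P \<rightarrow>\<^sub>M count_space UNIV"
proof -
  have [measurable]: "claim_time Y n \<in> borel_measurable P" for n
    by (rule claim_time_measurable)
  show ?thesis
    unfolding claim_count_def[abs_def] by (rule measurable_card) simp
qed

lemma total_claims_measurable: "total_claims Y U t \<in> borel_measurable P"
  unfolding total_claims_def[abs_def]
  by (rule measurable_compose_countable[OF _ claim_count_measurable,
        of "\<lambda>n \<omega>. \<Sum>i=1..n. U i \<omega>"]) (intro borel_measurable_sum claim_measurable, auto)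

lemma elapsed_measurable: "elapsed Y t \<in> borel_measurable P"
  unfolding elapsed_def[abs_def]
  by (intro borel_measurable_diff borel_measurable_const
      measurable_compose_countable[OF claim_time_measurable claim_count_measurable])

lemma sets_history_subset: "sets (history (space P) Y U t) \<subseteq> sets P"
proof -
  have "(\<lambda>\<omega>. real (claim_count Y r \<omega>)) \<in> borel_measurable P" for r
    using claim_count_measurable by (rule measurable_compose) simp
  note [measurable] = this total_claims_measurable elapsed_measurable
  show ?thesis
    unfolding history_def
    by (subst sets_measure_of) (auto intro!: sets.sigma_sets_subset measurable_sets)
qed

lemma sets_augmented_history_subset: "sets (augmented_history P Y U t) \<subseteq> sets (completion P)"
  unfolding augmented_history_def
proof (subst sets_measure_of)
  have *: "sets (history (space P) Y U t) \<union> null_sets (completion P) \<subseteq> sets (completion P)"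
    using sets_history_subset by (auto intro: sets_completionI_sets)
  then show "sets (history (space P) Y U t) \<union> null_sets (completion P) \<subseteq> Pow (space P)"
    using sets.space_closed[of "completion P"] by auto
  show "sigma_sets (space P) (sets (history (space P) Y U t) \<union> null_sets (completion P))
      \<subseteq> sets (completion P)"
    using sets.sigma_sets_subset[OF *] by simp
qed

end

lemma space_augmented_history: "space (augmented_history P Y U t) = space P"
  by (simp add: augmented_history_def space_measure_of_conv)

lemma history_generators_closed:
  "(\<Union>r\<in>{0..t}.
      {(\<lambda>\<omega>. real (claim_count Y r \<omega>)) -` B \<inter> \<Omega> | B. B \<in> sets borel} \<union>
      {total_claims Y U r -` B \<inter> \<Omega> | B. B \<in> sets borel} \<union>
      {elapsed Y r -` B \<inter> \<Omega> | B. B \<in> sets borel}) \<subseteq> Pow \<Omega>"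
  by auto

lemma sets_augmented_history_mono:
  assumes "a \<le> b"
  shows "sets (augmented_history P Y U a) \<subseteq> sets (augmented_history P Y U b)"
proof -
  have "sets (history (space P) Y U a) \<subseteq> sets (history (space P) Y U b)"
    unfolding history_def using assms
    unfolding sets_measure_of[OF history_generators_closed]
    by (intro sigma_sets_mono' UN_mono order_refl) auto
  moreover have "sets (history (space P) Y U r) \<union> null_sets (completion P) \<subseteq> Pow (space P)" for r
    using sets.space_closed[of "history (space P) Y U r"] sets.space_closed[of "completion P"]
    by (auto simp: history_def space_measure_of_conv null_sets_def)
  ultimately show ?thesis
    unfolding augmented_history_def by (simp only: sets_measure_of) (intro sigma_sets_mono' Un_mono order_refl)
qed

lemma total_claims_adapted:
  assumes "0 \<le> r" "r \<le> t"
  shows "total_claims Y U r \<in> borel_measurable (augmented_history P Y U t)"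
proof (rule measurableI)
  fix B :: "real set" assume "B \<in> sets borel"
  then have "total_claims Y U r -` B \<inter> space P \<in> sets (history (space P) Y U t)"
    unfolding history_def using assms
    by (subst sets_measure_of[OF history_generators_closed],
        intro sigma_sets.Basic UN_I[of r] UnI1 UnI2 CollectI exI[of _ B]) auto
  moreover have "sets (history (space P) Y U t) \<union> null_sets (completion P) \<subseteq> Pow (space P)"
    using sets.space_closed[of "history (space P) Y U t"] sets.space_closed[of "completion P"]
    by (auto simp: history_def space_measure_of_conv null_sets_def)
  ultimately show "total_claims Y U r -` B \<inter> space (augmented_history P Y U t)
      \<in> sets (augmented_history P Y U t)"
    unfolding space_augmented_history
    by (auto simp: augmented_history_def sets_measure_of intro: sigma_sets.Basic)
qed simp

lemma pred_Ball_countable: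
  assumes "countable X" "\<And>i. Measurable.pred M (P i)"
  shows "Measurable.pred M (\<lambda>x. \<forall>i\<in>X. P i x)"
  unfolding pred_def using assms by (intro sets.sets_Collect_countable_All' predE)

section \<open>Predictable processes\<close>

locale filtration_from =
  fixes s :: real and \<Omega> :: "'a set" and \<F> :: "real \<Rightarrow> 'a measure"
  assumes space_filtration: "\<And>t. space (\<F> t) = \<Omega>"
    and filtration_mono: "\<And>a b. a \<le> b \<Longrightarrow> sets (\<F> a) \<subseteq> sets (\<F> b)"
begin

lemma predictable_generators_closed:
  "{{s} \<times> A | A. A \<in> sets (\<F> s)} \<union>
      {{a<..b} \<times> A | a b A. s \<le> a \<and> a < b \<and> A \<in> sets (\<F> a)} \<subseteq> Pow ({s..} \<times> \<Omega>)"
  by (auto dest!: sets.sets_into_space simp: space_filtration)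

lemma space_predictable: "space (predictable_algebra s \<Omega> \<F>) = {s..} \<times> \<Omega>"
  unfolding predictable_algebra_def by (rule space_measure_of[OF predictable_generators_closed])

lemma sets_predictable:
  "sets (predictable_algebra s \<Omega> \<F>) = sigma_sets ({s..} \<times> \<Omega>)
     ({{s} \<times> A | A. A \<in> sets (\<F> s)} \<union>
      {{a<..b} \<times> A | a b A. s \<le> a \<and> a < b \<and> A \<in> sets (\<F> a)})"
  unfolding predictable_algebra_def by (rule sets_measure_of[OF predictable_generators_closed])

lemma section_measurable:
  assumes "s \<le> q"
  shows "(\<lambda>\<omega>. (q, \<omega>)) \<in> \<F> q \<rightarrow>\<^sub>M predictable_algebra s \<Omega> \<F>"
  unfolding predictable_algebra_def
proof (rule measurable_measure_of[OF predictable_generators_closed])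
  show "(\<lambda>\<omega>. (q, \<omega>)) \<in> space (\<F> q) \<rightarrow> {s..} \<times> \<Omega>"
    using assms by (auto simp: space_filtration)
  fix y assume "y \<in> {{s} \<times> A | A. A \<in> sets (\<F> s)} \<union>
      {{a<..b} \<times> A | a b A. s \<le> a \<and> a < b \<and> A \<in> sets (\<F> a)}"
  then consider A where "y = {s} \<times> A" "A \<in> sets (\<F> s)"
    | a b A where "y = {a<..b} \<times> A" "A \<in> sets (\<F> a)" by blast
  then show "(\<lambda>\<omega>. (q, \<omega>)) -` y \<inter> space (\<F> q) \<in> sets (\<F> q)"
  proof cases
    case 1
    then have "A \<in> sets (\<F> q)" using filtration_mono[OF assms] by auto
    moreover have "(\<lambda>\<omega>. (q, \<omega>)) -` y \<inter> space (\<F> q) = (if q = s then A \<inter> space (\<F> q) else {})"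
      using 1 by auto
    ultimately show ?thesis by auto
  next
    case 2
    have "(\<lambda>\<omega>. (q, \<omega>)) -` y \<inter> space (\<F> q) = (if a < q \<and> q \<le> b then A \<inter> space (\<F> q) else {})"
      using 2 by auto
    moreover have "A \<in> sets (\<F> q)" if "a < q"
      using filtration_mono[of a q] that 2 by auto
    ultimately show ?thesis by auto
  qed
qed

text \<open>
  The maximum with \<open>s\<close> extends a process on \<open>{s..}\<close> to all times, so that it can be integrated over
  \<open>lborel\<close>.
\<close>

lemma predictable_jointly_measurable:
  assumes sub: "\<And>t. sets (\<F> t) \<subseteq> sets N" and space: "space N = \<Omega>"
  shows "(\<lambda>(\<omega>, t). (max s t, \<omega>)) \<in> N \<Otimes>\<^sub>M borel \<rightarrow>\<^sub>M predictable_algebra s \<Omega> \<F>"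
  unfolding predictable_algebra_def
proof (rule measurable_measure_of[OF predictable_generators_closed])
  show "(\<lambda>(\<omega>, t). (max s t, \<omega>)) \<in> space (N \<Otimes>\<^sub>M borel) \<rightarrow> {s..} \<times> \<Omega>"
    by (auto simp: space_pair_measure space)
  fix y assume "y \<in> {{s} \<times> A | A. A \<in> sets (\<F> s)} \<union>
      {{a<..b} \<times> A | a b A. s \<le> a \<and> a < b \<and> A \<in> sets (\<F> a)}"
  then consider A where "y = {s} \<times> A" "A \<in> sets (\<F> s)"
    | a b A where "y = {a<..b} \<times> A" "s \<le> a" "A \<in> sets (\<F> a)" by blast
  then show "(\<lambda>(\<omega>, t). (max s t, \<omega>)) -` y \<inter> space (N \<Otimes>\<^sub>M borel) \<in> sets (N \<Otimes>\<^sub>M borel)"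
  proof cases
    case 1
    then have A: "A \<in> sets N" using sub by auto
    then have "(\<lambda>(\<omega>, t). (max s t, \<omega>)) -` y \<inter> space (N \<Otimes>\<^sub>M borel) = A \<times> {..s}"
      using 1 sets.sets_into_space[OF A] by (auto simp: space_pair_measure max_def split: if_splits)
    then show ?thesis using A by simp
  next
    case 2
    then have A: "A \<in> sets N" using sub by auto
    then have "(\<lambda>(\<omega>, t). (max s t, \<omega>)) -` y \<inter> space (N \<Otimes>\<^sub>M borel) = A \<times> {a<..b}"
      using 2 sets.sets_into_space[OF A] by (auto simp: space_pair_measure max_def split: if_splits)
    then show ?thesis using A by simp
  qed
qed

lemma after_predictable:
  assumes "s \<le> a" "A \<in> sets (\<F> a)"
  shows "{a<..} \<times> A \<in> sets (predictable_algebra s \<Omega> \<F>)"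
proof -
  have "{a<..a + real (Suc n)} \<times> A \<in> sets (predictable_algebra s \<Omega> \<F>)" for n
    unfolding sets_predictable using assms
    by (intro sigma_sets.Basic UnI2 CollectI exI[of _ a] exI[of _ "a + real (Suc n)"] exI[of _ A]) auto
  then have "(\<Union>n. {a<..a + real (Suc n)} \<times> A) \<in> sets (predictable_algebra s \<Omega> \<F>)"
    by (intro sets.countable_UN) auto
  also have "(\<Union>n. {a<..a + real (Suc n)} \<times> A) = {a<..} \<times> A"
  proof (intro equalityI subsetI)
    fix z assume z: "z \<in> {a<..} \<times> A"
    obtain n where "fst z - a \<le> real n" using real_arch_simple by blast
    then show "z \<in> (\<Union>n. {a<..a + real (Suc n)} \<times> A)"
      using z by (intro UN_I[of n]) auto
  qed auto
  finally show ?thesis .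
qed

lemma add_lump_sum_predictable:
  assumes "(\<lambda>(t, \<omega>). L t \<omega>) \<in> borel_measurable (predictable_algebra s \<Omega> \<F>)"
  shows "(\<lambda>(t, \<omega>). add_lump_sum s d L t \<omega>) \<in> borel_measurable (predictable_algebra s \<Omega> \<F>)"
proof -
  have [measurable]: "{s<..} \<times> \<Omega> \<in> sets (predictable_algebra s \<Omega> \<F>)"
    using sets.top[of "\<F> s"] by (intro after_predictable) (simp_all add: space_filtration)
  note assms[measurable]
  have "(\<lambda>z. if z \<in> {s<..} \<times> \<Omega> then (\<lambda>(t, \<omega>). L t \<omega>) z + d else 0)
      \<in> borel_measurable (predictable_algebra s \<Omega> \<F>)"
    by measurable
  then show ?thesis
    by (rule measurable_cong[THEN iffD1, rotated]) (auto simp: space_predictable add_lump_sum_def split: if_splits)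
qed

text \<open>
  The set where the supremum exceeds \<open>a \<ge> 0\<close> is the union over rational \<open>q\<close> of \<open>{q<..} \<times> A\<^sub>q\<close>, where \<open>A\<^sub>q\<close> is
  the event that the payment indexed by \<open>q\<close> exceeds \<open>a\<close>; and \<open>A\<^sub>q\<close> is known at time \<open>q\<close>.
\<close>

lemma withhold_predictable:
  assumes L: "(\<lambda>(t, \<omega>). L t \<omega>) \<in> borel_measurable (predictable_algebra s \<Omega> \<F>)"
    and path: "\<And>\<omega>. \<omega> \<in> \<Omega> \<Longrightarrow> dividend_path s L \<omega>"
    and claims: "\<And>r q. s \<le> r \<Longrightarrow> r \<le> q \<Longrightarrow> total_claims Y U r \<in> borel_measurable (\<F> q)"
  shows "(\<lambda>(t, \<omega>). withhold Y U p s T x d L t \<omega>) \<in> borel_measurable (predictable_algebra s \<Omega> \<F>)"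
proof (subst borel_measurable_iff_greater, intro allI)
  fix a :: real
  let ?S = "{z \<in> space (predictable_algebra s \<Omega> \<F>). a < (\<lambda>(t, \<omega>). withhold Y U p s T x d L t \<omega>) z}"
  let ?g = "excess_while_solvent Y U p s T x d L"
  have excess: "{\<omega> \<in> \<Omega>. a < ?g q \<omega>} \<in> sets (\<F> q)" if "s < q" for q
  proof -
    have L_q: "L q \<in> borel_measurable (\<F> q)"
      using measurable_compose[OF section_measurable[of q] L] that by simp
    have "Measurable.pred (\<F> q) (survives_unpaid Y U p s T x q)"
      unfolding survives_unpaid_def[abs_def]
    proof (rule pred_Ball_countable)
      show "countable (insert T \<rat>)" by (simp add: countable_rat)
      fix r
      let ?Q = "\<lambda>\<omega>. 0 \<le> x + p * (r - s) - (total_claims Y U r \<omega> - total_claims Y U s \<omega>)"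
      show "Measurable.pred (\<F> q) (\<lambda>\<omega>. s \<le> r \<and> r \<le> min q T \<longrightarrow> ?Q \<omega>)"
      proof (cases "s \<le> r \<and> r \<le> min q T")
        case True
        then have "total_claims Y U r \<in> borel_measurable (\<F> q)"
          "total_claims Y U s \<in> borel_measurable (\<F> q)"
          using that by (auto intro: claims)
        then have "Measurable.pred (\<F> q) ?Q"
          unfolding pred_def
          by (intro borel_measurable_le borel_measurable_diff borel_measurable_const)
        moreover have "(\<lambda>\<omega>. s \<le> r \<and> r \<le> min q T \<longrightarrow> ?Q \<omega>) = ?Q"
          using True by blast
        ultimately show ?thesis by (simp only:)
      next
        case False
        then have "(\<lambda>\<omega>. s \<le> r \<and> r \<le> min q T \<longrightarrow> ?Q \<omega>) = (\<lambda>\<omega>. True)"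
          by blast
        moreover have "Measurable.pred (\<F> q) (\<lambda>\<omega>. True)"
          unfolding pred_def by simp
        ultimately show ?thesis by (simp only:)
      qed
    qed
    then have survives: "{\<omega> \<in> space (\<F> q). survives_unpaid Y U p s T x q \<omega>} \<in> sets (\<F> q)"
      by (rule predE)
    have "(\<lambda>\<omega>. L q \<omega> - d) \<in> borel_measurable (\<F> q)"
      by (rule borel_measurable_diff[OF L_q borel_measurable_const])
    then have "(\<lambda>\<omega>. max 0 (L q \<omega> - d)) \<in> borel_measurable (\<F> q)"
      by (intro borel_measurable_max borel_measurable_const)
    from measurable_If[OF this borel_measurable_const survives]
    have "(\<lambda>\<omega>. if survives_unpaid Y U p s T x q \<omega> then max 0 (L q \<omega> - d) else 0)
        \<in> borel_measurable (\<F> q)" .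
    moreover have "?g q = (\<lambda>\<omega>. if survives_unpaid Y U p s T x q \<omega> then max 0 (L q \<omega> - d) else 0)"
      by (rule ext) (simp only: excess_while_solvent_def)
    ultimately have "?g q \<in> borel_measurable (\<F> q)"
      by (simp only:)
    then show ?thesis
      using borel_measurable_iff_greater[of "?g q" "\<F> q"] by (simp add: space_filtration)
  qed
  show "?S \<in> sets (predictable_algebra s \<Omega> \<F>)"
  proof (cases "0 \<le> a")
    case True
    have "?S = (\<Union>q\<in>{q \<in> \<rat>. s < q}. {q<..} \<times> {\<omega> \<in> \<Omega>. a < ?g q \<omega>})"
    proof (intro equalityI subsetI)
      fix z assume "z \<in> ?S"
      then obtain t \<omega> where z: "z = (t, \<omega>)" "s \<le> t" "\<omega> \<in> \<Omega>"
        and a: "a < withhold Y U p s T x d L t \<omega>"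
        unfolding space_predictable by auto
      interpret dividend_path s L \<omega>
        by (rule path) fact
      obtain q where "q \<in> \<rat>" "s < q" "q < t" "a < ?g q \<omega>"
        using a True by (rule less_withholdE)
      then show "z \<in> (\<Union>q\<in>{q \<in> \<rat>. s < q}. {q<..} \<times> {\<omega> \<in> \<Omega>. a < ?g q \<omega>})"
        using z by (intro UN_I[of q]) auto
    next
      fix z assume "z \<in> (\<Union>q\<in>{q \<in> \<rat>. s < q}. {q<..} \<times> {\<omega> \<in> \<Omega>. a < ?g q \<omega>})"
      then obtain q t \<omega> where z: "z = (t, \<omega>)" "q \<in> \<rat>" "s < q" "q < t" "\<omega> \<in> \<Omega>" "a < ?g q \<omega>"
        by auto
      interpret dividend_path s L \<omega>
        by (rule path) fact
      have "a < withhold Y U p s T x d L t \<omega>"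
        using excess_le_withhold[of q t Y U p T x d] z by simp
      then show "z \<in> ?S"
        unfolding space_predictable using z by simp
    qed
    also have "\<dots> \<in> sets (predictable_algebra s \<Omega> \<F>)"
    proof (rule sets.countable_UN'')
      show "countable {q \<in> \<rat>. s < q}"
        by (rule countable_subset[OF _ countable_rat]) auto
      show "{q<..} \<times> {\<omega> \<in> \<Omega>. a < ?g q \<omega>} \<in> sets (predictable_algebra s \<Omega> \<F>)"
        if "q \<in> {q \<in> \<rat>. s < q}" for q
        using that by (intro after_predictable excess) auto
    qed
    finally show ?thesis .
  next
    case False
    have "a < withhold Y U p s T x d L t \<omega>" if "\<omega> \<in> \<Omega>" for t \<omega>
    proof -
      interpret dividend_path s L \<omega> by (intro path that)
      show ?thesis
        using withhold_nonneg[of Y U p T x d t] False by simp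
    qed
    then have "?S = space (predictable_algebra s \<Omega> \<F>)"
      by (auto simp: space_predictable)
    then show ?thesis by simp
  qed
qed

lemma right_lim_jointly_measurable:
  assumes L: "(\<lambda>(t, \<omega>). L t \<omega>) \<in> borel_measurable (predictable_algebra s \<Omega> \<F>)"
    and path: "\<And>\<omega>. \<omega> \<in> \<Omega> \<Longrightarrow> dividend_path s L \<omega>"
    and N: "\<And>t. sets (\<F> t) \<subseteq> sets N" "space N = \<Omega>"
  shows "(\<lambda>(\<omega>, t :: real). right_lim L (max s t) \<omega>) \<in> borel_measurable (N \<Otimes>\<^sub>M borel)"
proof (rule borel_measurable_LIMSEQ_real)
  have [measurable]: "(\<lambda>(\<omega>, t). L (max s t) \<omega>) \<in> borel_measurable (N \<Otimes>\<^sub>M borel)"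
    using measurable_compose[OF predictable_jointly_measurable[OF N] L] by (simp add: split_beta')
  show "(\<lambda>(\<omega>, t). L (max s t + 1 / real (Suc n)) \<omega>) \<in> borel_measurable (N \<Otimes>\<^sub>M borel)" for n
  proof -
    have "(\<lambda>z. (\<lambda>(\<omega>, t). L (max s t) \<omega>) (fst z, max s (snd z) + 1 / real (Suc n)))
        \<in> borel_measurable (N \<Otimes>\<^sub>M borel)"
      by measurable
    moreover have "max s (max s t + 1 / real (Suc n)) = max s t + 1 / real (Suc n)" for t
      by (intro max_absorb2) (auto intro: add_increasing2)
    ultimately show ?thesis by (simp add: split_beta' del: of_nat_Suc)
  qed
  fix z :: "'a \<times> real" assume "z \<in> space (N \<Otimes>\<^sub>M borel)"
  then obtain \<omega> t where z: "z = (\<omega>, t)" "\<omega> \<in> \<Omega>"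
    using N by (auto simp: space_pair_measure)
  interpret dividend_path s L \<omega> by (rule path) fact
  have "filterlim (\<lambda>n. max s t + 1 / real (Suc n)) (at_right (max s t)) sequentially"
  proof (rule filterlim_at_withinI)
    show "(\<lambda>n. max s t + 1 / real (Suc n)) \<longlonglongrightarrow> max s t"
      using LIMSEQ_Suc[OF lim_1_over_n] tendsto_add[OF tendsto_const[of "max s t"]] by fastforce
  qed auto
  then have "(\<lambda>n. L (max s t + 1 / real (Suc n)) \<omega>) \<longlonglongrightarrow> right_lim L (max s t) \<omega>"
    by (rule filterlim_compose[OF right_lim_tendsto[OF max.cobounded1]])
  then show "(\<lambda>n. (\<lambda>(\<omega>, t). L (max s t + 1 / real (Suc n)) \<omega>) z)
      \<longlonglongrightarrow> (\<lambda>(\<omega>, t). right_lim L (max s t) \<omega>) z"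
    by (simp add: z)
qed

end

section \<open>Probabilities of the claim arrivals\<close>

text \<open>
  Conditionally on \<open>Z\<close> the interval is deterministic, and by independence the law of \<open>X\<close> does not change.
\<close>

lemma (in prob_space) prob_in_random_interval_le:
  fixes X Z :: "'a \<Rightarrow> real"
  assumes indep: "indep_var borel X borel Z" and h[measurable]: "h \<in> borel_measurable borel"
    and le: "\<And>a b. a \<le> b \<Longrightarrow> prob {\<omega> \<in> space M. a < X \<omega> \<and> X \<omega> \<le> b} \<le> C * (b - a)"
    and "0 \<le> l" "0 \<le> C"
  shows "prob {\<omega> \<in> space M. h (Z \<omega>) - l < X \<omega> \<and> X \<omega> \<le> h (Z \<omega>)} \<le> C * l"
proof -
  have [measurable]: "random_variable borel X" "random_variable borel Z"
    using indep by (auto dest: indep_var_rv1 indep_var_rv2)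
  interpret X: prob_space "distr M borel X" by (rule prob_space_distr) simp
  interpret Z: prob_space "distr M borel Z" by (rule prob_space_distr) simp
  interpret XZ: pair_sigma_finite "distr M borel X" "distr M borel Z" ..
  let ?S = "{z \<in> space (borel \<Otimes>\<^sub>M borel). h (snd z) - l < fst z \<and> fst z \<le> h (snd z)}"
  have S: "?S \<in> sets (borel \<Otimes>\<^sub>M borel)" by measurable
  have "emeasure M {\<omega> \<in> space M. h (Z \<omega>) - l < X \<omega> \<and> X \<omega> \<le> h (Z \<omega>)} =
      emeasure (distr M (borel \<Otimes>\<^sub>M borel) (\<lambda>\<omega>. (X \<omega>, Z \<omega>))) ?S"
    using S by (subst emeasure_distr) (auto intro!: arg_cong[where f="emeasure M"] simp: space_pair_measure)
  also have "\<dots> = emeasure (distr M borel X \<Otimes>\<^sub>M distr M borel Z) ?S"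
    using indep unfolding indep_var_distribution_eq by simp
  also have "\<dots> = (\<integral>\<^sup>+z. emeasure (distr M borel X) ((\<lambda>x. (x, z)) -` ?S) \<partial>distr M borel Z)"
    using S by (intro XZ.emeasure_pair_measure_alt2) simp
  also have "\<dots> \<le> (\<integral>\<^sup>+z. ennreal (C * l) \<partial>distr M borel Z)"
  proof (intro nn_integral_mono)
    fix z
    have "(\<lambda>x. (x, z)) -` ?S = {h z - l<..h z}"
      by (auto simp: space_pair_measure)
    then have "emeasure (distr M borel X) ((\<lambda>x. (x, z)) -` ?S) =
        emeasure M {\<omega> \<in> space M. h z - l < X \<omega> \<and> X \<omega> \<le> h z}"
      by (auto simp: emeasure_distr intro!: arg_cong[where f="emeasure M"])
    also have "\<dots> \<le> ennreal (C * l)"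
      using le[of "h z - l" "h z"] \<open>0 \<le> l\<close> \<open>0 \<le> C\<close>
      by (simp add: emeasure_eq_measure)
    finally show "emeasure (distr M borel X) ((\<lambda>x. (x, z)) -` ?S) \<le> ennreal (C * l)" .
  qed
  also have "\<dots> = ennreal (C * l)"
    using Z.emeasure_space_1 by simp
  finally show ?thesis
    using \<open>0 \<le> l\<close> \<open>0 \<le> C\<close> by (simp add: emeasure_eq_measure)
qed

context sparre_andersen
begin

lemma Y_measurable: "1 \<le> i \<Longrightarrow> Y i \<in> borel_measurable M"
  and U_measurable: "1 \<le> i \<Longrightarrow> U i \<in> borel_measurable M"
  using indep by (auto simp: indep_vars_def2 dest: bspec[where x="Inl i"] bspec[where x="Inr i"])

lemma wait_cdf_less_1: "0 \<le> a \<Longrightarrow> F a < 1"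
  using survival[of a] exp_gt_zero[of "- integral {0..a} lam"] by linarith

lemma wait_cdf_nonneg: "0 \<le> F a"
  using wait_cdf[of 1] by (auto simp: cdf_def)

definition hazard_bound :: real where
  "hazard_bound = (SUP t\<in>{0..}. lam t)"

lemma hazard_le_bound: "0 \<le> t \<Longrightarrow> lam t \<le> hazard_bound"
  unfolding hazard_bound_def
  by (intro cSUP_upper bounded_imp_bdd_above lam_bounded) simp

lemma hazard_bound_nonneg: "0 \<le> hazard_bound"
  using lam_nonneg[of 0] hazard_le_bound[of 0] by simp

end

text \<open>
  The model started at time \<open>s\<close> with elapsed waiting time \<open>w\<close>. The estimates below are in terms of
  \<open>hazard_bound\<close> and \<open>F\<close>, which involve neither \<open>s\<close> nor \<open>w\<close>; this is where the uniformity comes from.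
\<close>

locale conditional_model = sparre_andersen +
  fixes s w :: real
  assumes s: "s \<in> {0..T}" and w: "w \<in> {0..s}"
begin

abbreviation "P \<equiv> K s w"

lemma sets_P: "sets P = sets M" and prob_space_P: "prob_space P"
  using measurable_space[OF kernel[OF s], of w] w by (auto simp: space_prob_algebra)

lemma space_P: "space P = space M"
  by (rule sets_eq_imp_space_eq[OF sets_P])

sublocale P: prob_space P
  by (rule prob_space_P)

lemma wait_from_measurable: "1 \<le> k \<Longrightarrow> wait_from Y s k \<in> borel_measurable P"
  and claim_from_measurable: "1 \<le> k \<Longrightarrow> claim_from Y U s k \<in> borel_measurable P"
  using indep_after[OF s w]
  by (auto simp: P.indep_vars_def2 dest: bspec[where x="Inl k"] bspec[where x="Inr k"])

text \<open>
  The first waiting time has hazard rate \<open>lam (w + t)\<close>, so that its survival function \<open>e\<^sup>-\<^sup>H\<close> is Lipschitz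
  continuous with constant \<open>hazard_bound\<close>, whatever \<open>w\<close> is.
\<close>

lemma prob_first_wait_in_interval:
  assumes "a \<le> b"
  shows "P.prob {\<omega> \<in> space P. a < wait_from Y s 1 \<omega> \<and> wait_from Y s 1 \<omega> \<le> b} \<le> hazard_bound * (b - a)"
proof -
  note [measurable] = wait_from_measurable[of 1, simplified]
  let ?tail = "\<lambda>t. P.prob {\<omega> \<in> space P. t < wait_from Y s 1 \<omega>}"
  let ?H = "\<lambda>t. integral {w..w + t} lam"
  have tail: "?tail t = exp (- ?H t)" if "0 \<le> t" for t
    using first_wait[OF s w that] by (simp add: space_P)
  have tail': "?tail t = ?tail (max t 0)" for t
  proof (cases "t < 0")
    case True
    have "?tail 0 \<le> ?tail t"
      using True by (intro P.finite_measure_mono) auto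
    moreover have "?tail t \<le> 1" by simp
    ultimately have "?tail t = 1"
      using tail[of 0] by (intro antisym) auto
    then show ?thesis
      using True tail[of 0] by (simp add: max_absorb2)
  qed (simp add: max_def)
  define a' where "a' = max a 0"
  define b' where "b' = max b 0"
  have ab: "0 \<le> a'" "a' \<le> b'" "b' - a' \<le> b - a"
    using assms by (auto simp: a'_def b'_def)
  have "{\<omega> \<in> space P. a < wait_from Y s 1 \<omega> \<and> wait_from Y s 1 \<omega> \<le> b} =
      {\<omega> \<in> space P. a < wait_from Y s 1 \<omega>} - {\<omega> \<in> space P. b < wait_from Y s 1 \<omega>}"
    by auto
  then have "P.prob {\<omega> \<in> space P. a < wait_from Y s 1 \<omega> \<and> wait_from Y s 1 \<omega> \<le> b} = ?tail a - ?tail b"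
    using assms by (simp add: P.finite_measure_Diff subset_eq)
  also have "\<dots> = exp (- ?H a') - exp (- ?H b')"
    using tail'[of a, folded a'_def] tail'[of b, folded b'_def] tail[of a'] tail[of b'] ab by simp
  also have "\<dots> \<le> hazard_bound * (b' - a')"
  proof -
    have int: "lam integrable_on {u..v}" if "0 \<le> u" for u v
      using that by (intro integrable_continuous_real continuous_on_subset[OF lam_cont]) auto
    have w0: "0 \<le> w" using w by simp
    have split: "?H b' = ?H a' + integral {w + a'..w + b'} lam"
      using ab w0 by (intro Henstock_Kurzweil_Integration.integral_combine[symmetric] int) auto
    have "integral {w + a'..w + b'} lam \<le> integral {w + a'..w + b'} (\<lambda>_. hazard_bound)"
      using ab w0 by (intro integral_le int hazard_le_bound) auto
    also have "\<dots> = hazard_bound * (b' - a')"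
      using ab by simp
    finally have D: "integral {w + a'..w + b'} lam \<le> hazard_bound * (b' - a')" .
    have H: "0 \<le> ?H a'"
      using ab w0 by (intro Henstock_Kurzweil_Integration.integral_nonneg int lam_nonneg) auto
    have "exp (- ?H a') - exp (- ?H b') = exp (- ?H a') * (1 - exp (- integral {w + a'..w + b'} lam))"
      unfolding split by (simp add: right_diff_distrib mult_exp_exp)
    also have "\<dots> \<le> 1 * integral {w + a'..w + b'} lam"
    proof (rule mult_mono)
      show "1 - exp (- integral {w + a'..w + b'} lam) \<le> integral {w + a'..w + b'} lam"
        using exp_ge_add_one_self[of "- integral {w + a'..w + b'} lam"] by simp
      have "0 \<le> integral {w + a'..w + b'} lam"
        using ab w0 by (intro Henstock_Kurzweil_Integration.integral_nonneg int lam_nonneg) auto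
      then show "0 \<le> 1 - exp (- integral {w + a'..w + b'} lam)" by simp
    qed (use H in auto)
    finally show ?thesis using D by simp
  qed
  also have "\<dots> \<le> hazard_bound * (b - a)"
    using ab hazard_bound_nonneg by (intro mult_left_mono) auto
  finally show ?thesis .
qed

lemma prob_later_waits_le:
  "P.prob {\<omega> \<in> space P. \<forall>k\<in>{2..n + 1}. wait_from Y s k \<omega> \<le> a} \<le> F a ^ n"
proof (cases "n = 0")
  case False
  let ?X = "case_sum (wait_from Y s) (claim_from Y U s)"
  let ?J = "Inl ` {2..n + 1} :: (nat + nat) set"
  have J: "?J \<noteq> {}" "finite ?J" "?J \<subseteq> {1..} <+> {1..}"
    using False by auto
  have "P.prob (\<Inter>i\<in>?J. ?X i -` {..a} \<inter> space P) = (\<Prod>i\<in>?J. P.prob (?X i -` {..a} \<inter> space P))"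
    using J by (intro P.indep_varsD[OF indep_after[OF s w]]) auto
  also have "\<dots> = (\<Prod>k\<in>{2..n + 1}. P.prob (wait_from Y s k -` {..a} \<inter> space P))"
    by (subst prod.reindex) auto
  also have "\<dots> = (\<Prod>k\<in>{2..n + 1}. F a)"
  proof (rule prod.cong)
    fix k assume "k \<in> {2..n + 1}"
    then show "P.prob (wait_from Y s k -` {..a} \<inter> space P) = F a"
      using later_waits[OF s w, of k] wait_from_measurable[of k]
      by (auto simp: cdf_def measure_distr)
  qed simp
  also have "(\<Inter>i\<in>?J. ?X i -` {..a} \<inter> space P) = {\<omega> \<in> space P. \<forall>k\<in>{2..n + 1}. wait_from Y s k \<omega> \<le> a}"
    using False by auto
  finally show ?thesis by simp
qed simp

lemma AE_some_later_wait_greater: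
  assumes "0 \<le> a"
  shows "AE \<omega> in P. \<exists>k\<ge>2. a < wait_from Y s k \<omega>"
proof -
  let ?B = "{\<omega> \<in> space P. \<forall>k\<in>{2..}. wait_from Y s k \<omega> \<le> a}"
  have meas: "{\<omega> \<in> space P. \<forall>k\<in>I. wait_from Y s k \<omega> \<le> a} \<in> sets P" if "I \<subseteq> {2..}" for I
  proof (rule sets.sets_Collect_countable_All')
    fix k assume "k \<in> I"
    then have [measurable]: "wait_from Y s k \<in> borel_measurable P"
      using that by (intro wait_from_measurable) auto
    show "{\<omega> \<in> space P. wait_from Y s k \<omega> \<le> a} \<in> sets P" by measurable
  qed simp
  have "P.prob ?B \<le> F a ^ n" for n
    using meas by (intro order_trans[OF P.finite_measure_mono prob_later_waits_le]) auto
  moreover have "(\<lambda>n. F a ^ n) \<longlonglongrightarrow> 0"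
    using wait_cdf_less_1[OF assms] wait_cdf_nonneg by (intro LIMSEQ_realpow_zero)
  ultimately have "P.prob ?B \<le> 0"
    by (intro LIMSEQ_le_const) auto
  then have "?B \<in> null_sets P"
    using meas[of "{2..}"] by (auto simp: P.emeasure_eq_measure null_sets_def measure_le_0_iff)
  then show ?thesis
    by (rule AE_I'[of ?B]) (auto simp flip: not_less)
qed

lemma AE_claims_path: "AE \<omega> in P. claims_path Y U \<omega>"
proof -
  have "AE \<omega> in P. \<forall>n. \<exists>k\<ge>2. real n < wait_from Y s k \<omega>"
    by (subst AE_all_countable) (auto intro: AE_some_later_wait_greater)
  moreover have "AE \<omega> in P. \<omega> \<in> space M"
    using space_P by (intro AE_I2) simp
  ultimately show ?thesis
  proof eventually_elim
    fix \<omega> assume \<omega>: "\<omega> \<in> space M" and large: "\<forall>n. \<exists>k\<ge>2. real n < wait_from Y s k \<omega>"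
    show "claims_path Y U \<omega>"
    proof
      fix t
      obtain n where "t \<le> real n" using real_arch_simple by blast
      moreover obtain k where "2 \<le> k" "real n < wait_from Y s k \<omega>" using large by blast
      ultimately have k: "2 \<le> k" "t < wait_from Y s k \<omega>" by auto
      show "\<exists>n. t < claim_time Y n \<omega>"
      proof (rule ccontr)
        assume "\<not> ?thesis"
        then have "wait_from Y s k \<omega> \<le> t"
          using \<omega> k by (intro waits_bounded_if_claim_times_bounded) (auto simp: not_less intro: wait_nonneg)
        with k show False by simp
      qed
    qed (use \<omega> s wait_nonneg claim_nonneg in auto)
  qed
qed

text \<open>
  At the \<open>n\<close>-th claim the wealth that started at \<open>x\<close> is ruined if no dividends have been paid, but extra
  capital of less than \<open>2 * d\<close> would save it (or it is exactly 0).
\<close>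

definition near_ruin :: "real \<Rightarrow> real \<Rightarrow> nat \<Rightarrow> 'a set" where
  "near_ruin x d n = {\<omega> \<in> space P.
     (\<Sum>k=1..n. claim_from Y U s k \<omega>) - p * (\<Sum>k=1..n. wait_from Y s k \<omega>) \<in> {x..<x + 2 * d}}"

text \<open>
  Contains the event that more than \<open>N\<close> claims occur in \<open>{s..T}\<close>. The first waiting time is left out
  because its law depends on \<open>w\<close>.
\<close>

definition many_claims :: "nat \<Rightarrow> 'a set" where
  "many_claims N = {\<omega> \<in> space P. \<forall>k\<in>{2..N + 1}. wait_from Y s k \<omega> \<le> T}"

lemma near_ruin_sets: "near_ruin x d n \<in> sets P"
proof -
  have [measurable]: "(\<lambda>\<omega>. (\<Sum>k=1..n. claim_from Y U s k \<omega>) - p * (\<Sum>k=1..n. wait_from Y s k \<omega>))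
      \<in> borel_measurable P"
    by (intro borel_measurable_diff borel_measurable_times borel_measurable_const borel_measurable_sum
        wait_from_measurable claim_from_measurable) auto
  show ?thesis
    unfolding near_ruin_def by measurable
qed

lemma many_claims_sets: "many_claims N \<in> sets P"
  unfolding many_claims_def
proof (rule sets.sets_Collect_countable_All')
  fix k assume "k \<in> {2..N + 1}"
  then have [measurable]: "wait_from Y s k \<in> borel_measurable P"
    by (intro wait_from_measurable) auto
  show "{\<omega> \<in> space P. wait_from Y s k \<omega> \<le> T} \<in> sets P" by measurable
qed simp

text \<open>
  Among the variables that determine the \<open>n\<close>-th loss, the first waiting time is singled out: given all the
  others, it has to lie in an interval of length \<open>2 * d / p\<close>.
\<close>

lemma prob_near_ruin_le:
  assumes "1 \<le> n" "0 \<le> d"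
  shows "P.prob (near_ruin x d n) \<le> hazard_bound * (2 * d / p)"
proof -
  let ?X = "case_sum (wait_from Y s) (claim_from Y U s)"
  let ?A = "{Inl 1} :: (nat + nat) set"
  let ?B = "Inl ` {2..n} \<union> Inr ` {1..n} :: (nat + nat) set"
  define Z where "Z = (\<lambda>\<omega>. (\<Sum>k=1..n. claim_from Y U s k \<omega>) - p * (\<Sum>k=2..n. wait_from Y s k \<omega>))"
  have "P.indep_var (PiM ?A (\<lambda>_. borel)) (\<lambda>\<omega>. restrict (\<lambda>i. ?X i \<omega>) ?A)
      (PiM ?B (\<lambda>_. borel)) (\<lambda>\<omega>. restrict (\<lambda>i. ?X i \<omega>) ?B)"
    by (rule P.indep_var_restrict[OF indep_after[OF s w]]) auto
  from P.indep_var_compose[OF this, of "\<lambda>f. f (Inl 1)" borel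
      "\<lambda>f. (\<Sum>k=1..n. f (Inr k)) - p * (\<Sum>k=2..n. f (Inl k))" borel]
  have "P.indep_var borel ((\<lambda>f. f (Inl 1)) \<circ> (\<lambda>\<omega>. restrict (\<lambda>i. ?X i \<omega>) ?A))
      borel ((\<lambda>f. (\<Sum>k=1..n. f (Inr k)) - p * (\<Sum>k=2..n. f (Inl k))) \<circ> (\<lambda>\<omega>. restrict (\<lambda>i. ?X i \<omega>) ?B))"
    by (auto intro!: borel_measurable_diff borel_measurable_times borel_measurable_sum
        measurable_component_singleton)
  also have "(\<lambda>f. f (Inl 1)) \<circ> (\<lambda>\<omega>. restrict (\<lambda>i. ?X i \<omega>) ?A) = wait_from Y s 1"
    by (auto simp: fun_eq_iff)
  also have "(\<lambda>f. (\<Sum>k=1..n. f (Inr k)) - p * (\<Sum>k=2..n. f (Inl k))) \<circ> (\<lambda>\<omega>. restrict (\<lambda>i. ?X i \<omega>) ?B) = Z"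
    by (auto simp: fun_eq_iff Z_def)
  finally have indep: "P.indep_var borel (wait_from Y s 1) borel Z" .
  have "near_ruin x d n = {\<omega> \<in> space P.
      (Z \<omega> - x) / p - 2 * d / p < wait_from Y s 1 \<omega> \<and> wait_from Y s 1 \<omega> \<le> (Z \<omega> - x) / p}"
  proof -
    have "(\<Sum>k=1..n. wait_from Y s k \<omega>) = wait_from Y s 1 \<omega> + (\<Sum>k=2..n. wait_from Y s k \<omega>)" for \<omega>
      using assms(1) by (subst sum.atLeast_Suc_atMost) (auto simp: numeral_2_eq_2)
    then show ?thesis
      using p_pos by (auto simp: near_ruin_def Z_def diff_divide_distrib[symmetric] pos_divide_less_eq pos_le_divide_eq
          algebra_simps)
  qed
  also have "P.prob \<dots> \<le> hazard_bound * (2 * d / p)"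
    using assms p_pos hazard_bound_nonneg
    by (intro P.prob_in_random_interval_le[OF indep, of "\<lambda>z. (z - x) / p"] prob_first_wait_in_interval) auto
  finally show ?thesis .
qed

lemma prob_near_ruin_or_many_claims_le:
  assumes "0 \<le> d"
  shows "P.prob ((\<Union>n\<in>{1..N}. near_ruin x d n) \<union> many_claims N)
    \<le> real N * (hazard_bound * (2 * d / p)) + F T ^ N"
proof -
  have "P.prob ((\<Union>n\<in>{1..N}. near_ruin x d n) \<union> many_claims N)
      \<le> P.prob (\<Union>n\<in>{1..N}. near_ruin x d n) + P.prob (many_claims N)"
    by (intro measure_Un_le sets.finite_UN near_ruin_sets many_claims_sets) auto
  also have "\<dots> \<le> (\<Sum>n\<in>{1..N}. hazard_bound * (2 * d / p)) + F T ^ N"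
  proof (rule add_mono)
    have "P.prob (\<Union>n\<in>{1..N}. near_ruin x d n) \<le> (\<Sum>n\<in>{1..N}. P.prob (near_ruin x d n))"
      using near_ruin_sets by (intro P.finite_measure_subadditive_finite) auto
    also have "\<dots> \<le> (\<Sum>n\<in>{1..N}. hazard_bound * (2 * d / p))"
      using assms by (intro sum_mono prob_near_ruin_le) auto
    finally show "P.prob (\<Union>n\<in>{1..N}. near_ruin x d n) \<le> (\<Sum>n\<in>{1..N}. hazard_bound * (2 * d / p))" .
    show "P.prob (many_claims N) \<le> F T ^ N"
      unfolding many_claims_def by (rule prob_later_waits_le)
  qed
  finally show ?thesis by simp
qed

lemma not_near_ruin_gap:
  assumes path: "claims_path Y U \<omega>" and \<omega>: "\<omega> \<in> space P"
    "\<omega> \<notin> (\<Union>n\<in>{1..N}. near_ruin x d n) \<union> many_claims N"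
    and n: "1 \<le> n" "s + (\<Sum>k=1..n. wait_from Y s k \<omega>) \<le> T"
  shows "(\<Sum>k=1..n. claim_from Y U s k \<omega>) - p * (\<Sum>k=1..n. wait_from Y s k \<omega>) \<notin> {x..<x + 2 * d}"
proof (cases "n \<le> N")
  case True
  then show ?thesis
    using \<omega> n by (auto simp: near_ruin_def)
next
  case False
  interpret claims_path Y U s \<omega> by fact
  have "wait_from Y s k \<omega> \<le> T" if "k \<in> {2..N + 1}" for k
  proof -
    have "wait_from Y s k \<omega> \<le> (\<Sum>k=1..n. wait_from Y s k \<omega>)"
      using that False by (intro member_le_sum wait_from_nonneg) auto
    then show ?thesis using n(2) s by simp
  qed
  then have "\<omega> \<in> many_claims N"
    using \<omega> by (simp add: many_claims_def)
  then show ?thesis using \<omega> by simp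
qed

end

section \<open>Admissible strategies and their payoffs\<close>

context conditional_model
begin

abbreviation "adm \<equiv> admissible T p Y U P s"
abbreviation "dd \<equiv> discounted_dividends T p c Y U s"
abbreviation "J \<equiv> dividend_payoff T p c Y U P s"
abbreviation "\<A> \<equiv> augmented_history P Y U"

lemma horizon: "s \<le> T"
  using s by simp

sublocale \<A>: filtration_from s "space P" \<A>
  by unfold_locales (auto simp: space_augmented_history sets_augmented_history_mono)

lemma sets_\<A>_subset: "sets (\<A> t) \<subseteq> sets (completion P)"
  using Y_measurable U_measurable measurable_cong_sets[OF sets_P refl]
  by (intro sets_augmented_history_subset) auto

lemma dividend_path_if_admissible: "adm x L \<Longrightarrow> \<omega> \<in> space P \<Longrightarrow> dividend_path s L \<omega>"
  by (auto simp: admissible_def intro!: dividend_path.intro)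

lemma AE_admissible_path:
  assumes "adm x L" "0 \<le> x"
  shows "AE \<omega> in P. admissible_path s L \<omega> Y U T p x"
proof -
  have "AE \<omega> in P. \<forall>t\<in>{s..T}.
        (ereal t < ruin_time p Y U s x L \<omega> \<longrightarrow>
           L t \<omega> \<le> right_lim L t \<omega> \<and>
           right_lim L t \<omega> \<le> x + p * (t - s) - total_claims_from Y U s t \<omega>) \<and>
        (ruin_time p Y U s x L \<omega> \<le> ereal t \<longrightarrow>
           right_lim L t \<omega> = L (real_of_ereal (ruin_time p Y U s x L \<omega>)) \<omega>)"
    using assms by (simp add: admissible_def)
  with AE_claims_path AE_space show ?thesis
  proof eventually_elim
    case (elim \<omega>)
    interpret dividend_path s L \<omega>
      using assms(1) elim(2) by (rule dividend_path_if_admissible)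
    interpret claims_path Y U s \<omega> by fact
    show ?case
    proof
      show "L t \<omega> = right_lim L T \<omega>" if "T < t" for t
        using assms(1) elim(2) that by (simp add: admissible_def)
    qed (use elim(3) horizon p_pos assms in auto)
  qed
qed

lemma admissibleI:
  assumes "(\<lambda>(t, \<omega>). L t \<omega>) \<in> borel_measurable (predictable_algebra s (space P) \<A>)"
    and path: "\<And>\<omega>. \<omega> \<in> space P \<Longrightarrow> dividend_path s L \<omega>"
    and const: "\<And>\<omega> t. \<omega> \<in> space P \<Longrightarrow> T < t \<Longrightarrow> L t \<omega> = right_lim L T \<omega>"
    and AE: "AE \<omega> in P. admissible_path s L \<omega> Y U T p x"
  shows "adm x L"
  unfolding admissible_def
proof (intro conjI ballI)
  fix \<omega> assume \<omega>: "\<omega> \<in> space P"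
  interpret dividend_path s L \<omega> by (rule path) fact
  show "L s \<omega> = 0" "mono_on {s..} (\<lambda>t. L t \<omega>)"
    by (rule start, rule mono)
  show "\<forall>t>s. continuous (at_left t) (\<lambda>r. L r \<omega>)"
    using left_cont by blast
  show "\<forall>t>T. L t \<omega> = right_lim L T \<omega>"
    using const \<omega> by blast
next
  show "AE \<omega> in P. \<forall>t\<in>{s..T}.
        (ereal t < ruin_time p Y U s x L \<omega> \<longrightarrow>
           L t \<omega> \<le> right_lim L t \<omega> \<and>
           right_lim L t \<omega> \<le> x + p * (t - s) - total_claims_from Y U s t \<omega>) \<and>
        (ruin_time p Y U s x L \<omega> \<le> ereal t \<longrightarrow>
           right_lim L t \<omega> = L (real_of_ereal (ruin_time p Y U s x L \<omega>)) \<omega>)"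
    using AE
  proof eventually_elim
    case (elim \<omega>)
    interpret admissible_path s L \<omega> Y U T p x by fact
    show ?case
      using right_lim_ge solvent stopped by simp
  qed
qed (rule assms(1))

lemma admissible_zero:
  assumes "0 \<le> x"
  shows "adm x (\<lambda>_ _. 0)"
proof (rule admissibleI)
  have right_lim: "right_lim (\<lambda>_ _. 0) t \<omega> = 0" for t and \<omega> :: 'a
    unfolding right_lim_def by (rule tendsto_Lim) auto
  show path: "dividend_path s (\<lambda>_ _. 0) \<omega>" for \<omega> :: 'a
    by unfold_locales (auto simp: mono_on_def)
  show "(0 :: real) = right_lim (\<lambda>_ _. 0) T \<omega>" for \<omega> :: 'a
    by (simp add: right_lim)
  show "AE \<omega> in P. admissible_path s (\<lambda>_ _. 0) \<omega> Y U T p x"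
    using AE_claims_path
  proof eventually_elim
    case (elim \<omega>)
    interpret dividend_path s "\<lambda>_ _. 0" \<omega> by (rule path)
    interpret claims_path Y U s \<omega> by fact
    show ?case
    proof
      fix t assume "s \<le> t" "ereal t < ruin_time p Y U s x (\<lambda>_ _. 0) \<omega>"
      then show "right_lim (\<lambda>_ _. 0) t \<omega> \<le> x + p * (t - s) - claims t"
        using wealth_nonneg_before_ruin by (fastforce simp: right_lim wealth_def)
    qed (use horizon p_pos assms right_lim in auto)
  qed
qed simp

lemma admissible_add_lump_sum:
  assumes L: "adm x L" and "0 \<le> x" "0 \<le> d"
  shows "adm (x + d) (add_lump_sum s d L)"
proof (rule admissibleI)
  show "(\<lambda>(t, \<omega>). add_lump_sum s d L t \<omega>) \<in> borel_measurable (predictable_algebra s (space P) \<A>)"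
    using L by (intro \<A>.add_lump_sum_predictable) (simp add: admissible_def)
  fix \<omega> assume \<omega>: "\<omega> \<in> space P"
  interpret dividend_path s L \<omega>
    by (rule dividend_path_if_admissible[OF L \<omega>])
  show "dividend_path s (add_lump_sum s d L) \<omega>"
    by (rule dividend_path_add_lump_sum[OF \<open>0 \<le> d\<close>])
  show "add_lump_sum s d L t \<omega> = right_lim (add_lump_sum s d L) T \<omega>" if "T < t" for t
    using L \<omega> that horizon
    by (simp add: right_lim_add_lump_sum[OF \<open>0 \<le> d\<close>] admissible_def add_lump_sum_def)
next
  show "AE \<omega> in P. admissible_path s (add_lump_sum s d L) \<omega> Y U T p (x + d)"
    using AE_admissible_path[OF L \<open>0 \<le> x\<close>]
    by eventually_elim (rule admissible_path.admissible_path_add_lump_sum[OF _ \<open>0 \<le> d\<close>])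
qed

lemma admissible_withhold:
  assumes L: "adm (x + d) L" and "0 \<le> x" "0 \<le> d"
  shows "adm x (withhold Y U p s T x d L)"
proof (rule admissibleI)
  show "(\<lambda>(t, \<omega>). withhold Y U p s T x d L t \<omega>)
      \<in> borel_measurable (predictable_algebra s (space P) \<A>)"
    using L s dividend_path_if_admissible[OF L]
    by (intro \<A>.withhold_predictable total_claims_adapted) (auto simp: admissible_def)
  fix \<omega> assume \<omega>: "\<omega> \<in> space P"
  interpret dividend_path s L \<omega>
    by (rule dividend_path_if_admissible[OF L \<omega>])
  show "dividend_path s (withhold Y U p s T x d L) \<omega>"
    by (rule dividend_path_withhold)
  show "withhold Y U p s T x d L t \<omega> = right_lim (withhold Y U p s T x d L) T \<omega>" if "T < t" for t
    using L \<omega> that by (intro withhold_after_horizon horizon) (auto simp: admissible_def)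
next
  have "0 \<le> x + d" using assms by simp
  from AE_admissible_path[OF L this]
  show "AE \<omega> in P. admissible_path s (withhold Y U p s T x d L) \<omega> Y U T p x"
  proof eventually_elim
    case (elim \<omega>)
    then show ?case
      using assms by (intro admissible_path.admissible_path_withhold[where x="x + d"] refl)
  qed
qed

text \<open>
  By integration by parts the payoff is almost surely a parameter integral of the jointly measurable
  process \<open>L\<^sub>u\<^sub>+\<close>, and the completion makes almost sure equality sufficient.
\<close>

lemma payoff_measurable:
  assumes L: "adm x L" and "0 \<le> x"
  shows "dd x L \<in> borel_measurable (completion P)"
proof -
  define I where "I \<omega> = exp (- c * (T - s)) * right_lim L (max s T) \<omega> +
    (\<integral>u. indicator {s..T} u * (c * exp (- c * (u - s)) * right_lim L (max s u) \<omega>) \<partial>lborel)" for \<omega>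
  have joint: "(\<lambda>(\<omega>, t :: real). right_lim L (max s t) \<omega>) \<in> borel_measurable (completion P \<Otimes>\<^sub>M borel)"
    using L dividend_path_if_admissible[OF L]
    by (intro \<A>.right_lim_jointly_measurable sets_\<A>_subset) (auto simp: admissible_def)
  note [measurable] = joint
  have "(\<lambda>\<omega>. right_lim L (max s T) \<omega>) \<in> borel_measurable (completion P)"
    using measurable_compose[OF measurable_Pair2'[of T borel "completion P"] joint] by simp
  moreover have "(\<lambda>\<omega>. \<integral>u. indicator {s..T} u * (c * exp (- c * (u - s)) * right_lim L (max s u) \<omega>) \<partial>lborel)
      \<in> borel_measurable (completion P)"
    by (intro lborel.borel_measurable_lebesgue_integral) (simp add: split_beta', measurable)
  ultimately have I: "I \<in> borel_measurable (completion P)"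
    unfolding I_def[abs_def] by (intro borel_measurable_add borel_measurable_times borel_measurable_const)
  have "AE \<omega> in P. dd x L \<omega> = I \<omega>"
    using AE_admissible_path[OF assms]
  proof eventually_elim
    case (elim \<omega>)
    interpret admissible_path s L \<omega> Y U T p x by fact
    have "(LINT u:{s..T}|lborel. c * exp (- c * (u - s)) * right_lim L u \<omega>) =
        (LINT u:{s..T}|lborel. c * exp (- c * (u - s)) * right_lim L (max s u) \<omega>)"
      by (intro set_lebesgue_integral_cong) auto
    then show ?case
      using s by (simp add: discounted_dividends_eq[OF c_pos] I_def set_lebesgue_integral_def max_absorb2)
  qed
  then have ae: "AE \<omega> in completion P. dd x L \<omega> = I \<omega>"
    by (rule AE_completion)
  show ?thesis
  proof (rule measurableI)
    fix B :: "real set" assume B: "B \<in> sets borel"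
    show "dd x L -` B \<inter> space (completion P) \<in> sets (completion P)"
    proof (rule completion.in_sets_AE)
      show "I -` B \<inter> space (completion P) \<in> sets (completion P)"
        using I B by (rule measurable_sets)
      show "AE \<omega> in completion P. (\<omega> \<in> I -` B \<inter> space (completion P)) =
          (\<omega> \<in> dd x L -` B \<inter> space (completion P))"
        using ae by eventually_elim auto
    qed auto
  qed simp
qed

sublocale cP: prob_space "completion P"
  by (rule P.prob_space_completion)

lemma AE_payoff_bounds:
  assumes "adm x L" "0 \<le> x"
  shows "AE \<omega> in completion P. 0 \<le> dd x L \<omega> \<and> dd x L \<omega> \<le> x + p * (T - s)"
  using AE_completion[OF AE_admissible_path[OF assms]]
proof eventually_elim
  case (elim \<omega>)
  then show ?case
    using admissible_path.discounted_dividends_bounds[OF elim c_pos] by simp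
qed

lemma payoff_integrable:
  assumes "adm x L" "0 \<le> x"
  shows "integrable (completion P) (dd x L)"
proof (rule cP.integrable_const_bound)
  show "AE \<omega> in completion P. norm (dd x L \<omega>) \<le> x + p * (T - s)"
    using AE_payoff_bounds[OF assms] by eventually_elim auto
qed (rule payoff_measurable[OF assms])

lemma payoff_le:
  assumes "adm x L" "0 \<le> x"
  shows "J x L \<le> x + p * (T - s)"
proof -
  have "J x L \<le> (\<integral>\<omega>. x + p * (T - s) \<partial>completion P)"
    unfolding dividend_payoff_def using AE_payoff_bounds[OF assms]
    by (intro integral_mono_AE payoff_integrable[OF assms]) auto
  then show ?thesis by (simp add: P.prob_space)
qed

lemma payoff_le_value:
  assumes "adm x L" "0 \<le> x"
  shows "J x L \<le> value_fn T p c Y U K s x w"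
  unfolding value_fn_def
proof (rule cSUP_upper)
  show "bdd_above (J x ` {L. adm x L})"
    using payoff_le[OF _ \<open>0 \<le> x\<close>] by (intro bdd_aboveI2[where M="x + p * (T - s)"]) auto
qed (use assms in simp)

lemma value_le:
  assumes "0 \<le> x" "\<And>L. adm x L \<Longrightarrow> J x L \<le> B"
  shows "value_fn T p c Y U K s x w \<le> B"
  unfolding value_fn_def
proof (rule cSUP_least)
  show "{L. adm x L} \<noteq> {}"
    using admissible_zero[OF \<open>0 \<le> x\<close>] by blast
qed (simp add: assms(2))

lemma value_add_le:
  assumes "0 \<le> x" "0 \<le> d"
  shows "value_fn T p c Y U K s x w + d \<le> value_fn T p c Y U K s (x + d) w"
proof -
  have "J x L \<le> value_fn T p c Y U K s (x + d) w - d" if L: "adm x L" for L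
  proof -
    let ?L' = "add_lump_sum s d L"
    have L': "adm (x + d) ?L'"
      using L assms by (rule admissible_add_lump_sum)
    have xd: "0 \<le> x + d" using assms by simp
    have "AE \<omega> in completion P. dd x L \<omega> \<le> dd (x + d) ?L' \<omega> + - d"
      using AE_completion[OF AE_admissible_path[OF L \<open>0 \<le> x\<close>]]
        AE_completion[OF AE_admissible_path[OF L' xd]]
    proof eventually_elim
      case (elim \<omega>)
      interpret admissible_path s L \<omega> Y U T p x by fact
      show ?case
        using elim by (rule discounted_dividends_mono)
          (simp_all add: c_pos right_lim_add_lump_sum[OF \<open>0 \<le> d\<close>])
    qed
    then have "J x L \<le> (\<integral>\<omega>. dd (x + d) ?L' \<omega> + - d \<partial>completion P)"
      unfolding dividend_payoff_def
      by (intro integral_mono_AE payoff_integrable L \<open>0 \<le> x\<close> Bochner_Integration.integrable_add L' xd) auto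
    also have "\<dots> = J (x + d) ?L' - d"
      unfolding dividend_payoff_def using payoff_integrable[OF L' xd]
      by (subst Bochner_Integration.integral_add) (auto simp: P.prob_space)
    also have "\<dots> \<le> value_fn T p c Y U K s (x + d) w - d"
      using payoff_le_value[OF L' xd] by simp
    finally show ?thesis .
  qed
  then have "value_fn T p c Y U K s x w \<le> value_fn T p c Y U K s (x + d) w - d"
    by (rule value_le[OF \<open>0 \<le> x\<close>])
  then show ?thesis by simp
qed

text \<open>
  On the exceptional event \<open>B\<close> the loss in payoff is bounded by the largest possible payoff
  \<open>x + d + p * T\<close>; elsewhere it is at most \<open>d\<close>.
\<close>

lemma value_diff_le:
  assumes "0 \<le> x" "0 < d"
  shows "value_fn T p c Y U K s (x + d) w \<le> value_fn T p c Y U K s x w + d +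
    (x + d + p * T) * (real N * (hazard_bound * (2 * d / p)) + F T ^ N)"
proof -
  define B where "B = (\<Union>n\<in>{1..N}. near_ruin x d n) \<union> many_claims N"
  define C where "C = x + d + p * T"
  have xd: "0 \<le> x + d" and C: "0 \<le> C"
    using assms p_pos T_pos by (auto simp: C_def)
  have B: "B \<in> sets P"
    unfolding B_def by (intro sets.Un sets.finite_UN near_ruin_sets many_claims_sets) auto
  have prob_B: "P.prob B \<le> real N * (hazard_bound * (2 * d / p)) + F T ^ N"
    unfolding B_def using assms by (intro prob_near_ruin_or_many_claims_le) simp
  have "J (x + d) L \<le> value_fn T p c Y U K s x w + d + C * P.prob B" if L: "adm (x + d) L" for L
  proof -
    let ?L' = "withhold Y U p s T x d L"
    have L': "adm x ?L'"
      using assms by (intro admissible_withhold L) auto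
    have "AE \<omega> in completion P. dd (x + d) L \<omega> \<le> dd x ?L' \<omega> + (d + C * indicator B \<omega>)"
      using AE_completion[OF AE_admissible_path[OF L xd]]
        AE_completion[OF AE_admissible_path[OF L' \<open>0 \<le> x\<close>]] AE_space
        AE_payoff_bounds[OF L xd] AE_payoff_bounds[OF L' \<open>0 \<le> x\<close>]
    proof eventually_elim
      case (elim \<omega>)
      interpret admissible_path s L \<omega> Y U T p "x + d" by (rule elim(1))
      show ?case
      proof (cases "\<omega> \<in> B")
        case True
        have "p * (T - s) \<le> p * T" using p_pos s by simp
        then show ?thesis
          using True elim(4,5) \<open>0 < d\<close> by (simp add: C_def)
      next
        case False
        have "claims_path Y U \<omega>" by unfold_locales
        then have gap: "(\<Sum>k=1..n. claim_from Y U s k \<omega>) - p * (\<Sum>k=1..n. wait_from Y s k \<omega>) \<notin> {x..<x + 2 * d}"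
          if "1 \<le> n" "s + (\<Sum>k=1..n. wait_from Y s k \<omega>) \<le> T" for n
          using that False elim(3) unfolding B_def by (intro not_near_ruin_gap[where N=N]) auto
        have "dd (x + d) L \<omega> \<le> dd x ?L' \<omega> + d"
        proof (rule discounted_dividends_mono[OF elim(1,2) c_pos])
          fix t assume "s \<le> t" "t \<le> T"
          then show "right_lim L t \<omega> \<le> right_lim ?L' t \<omega> + d"
            using assms gap
            by (intro right_lim_le_withheld ruin_if_unpaid_ruined[of x d]) auto
        qed
        then show ?thesis using False by simp
      qed
    qed
    moreover have int_CB: "integrable (completion P) (\<lambda>\<omega>. C * indicator B \<omega>)"
      using B by (intro integrable_mult_right integrable_real_indicator)
        (auto simp: cP.emeasure_eq_measure)
    moreover have int_B: "integrable (completion P) (\<lambda>\<omega>. d + C * indicator B \<omega>)"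
      by (rule Bochner_Integration.integrable_add[OF cP.integrable_const int_CB])
    note int = payoff_integrable[OF L' \<open>0 \<le> x\<close>] int_B
    ultimately have "J (x + d) L \<le> (\<integral>\<omega>. dd x ?L' \<omega> + (d + C * indicator B \<omega>) \<partial>completion P)"
      unfolding dividend_payoff_def
      by (intro integral_mono_AE[OF payoff_integrable[OF L xd] Bochner_Integration.integrable_add[OF int]])
    also have "\<dots> = J x ?L' + (\<integral>\<omega>. d + C * indicator B \<omega> \<partial>completion P)"
      unfolding dividend_payoff_def by (rule Bochner_Integration.integral_add[OF int])
    also have "(\<integral>\<omega>. d + C * indicator B \<omega> \<partial>completion P) = d + C * P.prob B"
    proof -
      have "(\<integral>\<omega>. d + C * indicator B \<omega> \<partial>completion P) =
          (\<integral>\<omega>. d \<partial>completion P) + (\<integral>\<omega>. C * indicator B \<omega> \<partial>completion P)"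
        by (rule Bochner_Integration.integral_add[OF cP.integrable_const int_CB])
      then show ?thesis
        using B by (simp add: P.prob_space Int_absorb2 sets.sets_into_space[OF B])
    qed
    finally show ?thesis
      using payoff_le_value[OF L' \<open>0 \<le> x\<close>] by simp
  qed
  then have "value_fn T p c Y U K s (x + d) w \<le> value_fn T p c Y U K s x w + d + C * P.prob B"
    by (rule value_le[OF xd])
  also have "\<dots> \<le> value_fn T p c Y U K s x w + d + C * (real N * (hazard_bound * (2 * d / p)) + F T ^ N)"
    using prob_B C by (intro add_left_mono mult_left_mono)
  finally show ?thesis by (simp add: C_def)
qed

end

section \<open>Growth and uniform continuity of the value function\<close>

context sparre_andersen
begin

lemma value_diff_ge:
  assumes "x2 \<le> x1" "0 \<le> x2" "0 \<le> w" "w \<le> s" "s \<le> T"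
  shows "x1 - x2 \<le> value_fn T p c Y U K s x1 w - value_fn T p c Y U K s x2 w"
proof -
  interpret conditional_model M T p c F f lam G Y U K s w
    using assms by unfold_locales auto
  show ?thesis
    using value_add_le[of x2 "x1 - x2"] assms by simp
qed

text \<open>
  \<open>N\<close> is chosen first, to make the probability of many claims small; after that the bound of
  \<open>value_diff_le\<close> is linear in \<open>d\<close> up to this small error, with slope \<open>D\<close>.
\<close>

lemma value_uniformly_continuous:
  assumes "0 < \<epsilon>"
  obtains \<delta> where "0 < \<delta>" "\<And>s x x' w. 0 \<le> w \<Longrightarrow> w \<le> s \<Longrightarrow> s \<le> T \<Longrightarrow> 0 \<le> x \<Longrightarrow> 0 \<le> x' \<Longrightarrow>
    x \<le> X \<Longrightarrow> x' \<le> X \<Longrightarrow> \<bar>x - x'\<bar> < \<delta> \<Longrightarrow>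
    \<bar>value_fn T p c Y U K s x w - value_fn T p c Y U K s x' w\<bar> < \<epsilon>"
proof -
  define C where "C = max X 0 + p * T"
  have C: "0 < C" using p_pos T_pos by (simp add: C_def add_nonneg_pos)
  obtain N where N: "F T ^ N < \<epsilon> / (2 * C)"
    using real_arch_pow_inv[of "\<epsilon> / (2 * C)" "F T"] wait_cdf_less_1[of T] T_pos C assms by auto
  define D where "D = 1 + C * (real N * (hazard_bound * (2 / p)))"
  have D: "0 < D"
    unfolding D_def using C p_pos hazard_bound_nonneg by (intro add_pos_nonneg mult_nonneg_nonneg) auto
  show ?thesis
  proof (rule that[of "\<epsilon> / (2 * D)"])
    show "0 < \<epsilon> / (2 * D)" using assms D by simp
    have main: "\<bar>value_fn T p c Y U K s x w - value_fn T p c Y U K s x' w\<bar> < \<epsilon>"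
      if sw: "0 \<le> w" "w \<le> s" "s \<le> T" and x: "0 \<le> x'" "x' < x" "x \<le> X" and close: "x - x' < \<epsilon> / (2 * D)"
      for s x x' w
    proof -
      interpret conditional_model M T p c F f lam G Y U K s w
        using sw by unfold_locales auto
      define d where "d = x - x'"
      have d: "0 < d" "x = x' + d" using x by (auto simp: d_def)
      let ?q = "real N * (hazard_bound * (2 * d / p)) + F T ^ N"
      have q: "0 \<le> ?q"
        using d p_pos hazard_bound_nonneg wait_cdf_nonneg
        by (intro add_nonneg_nonneg mult_nonneg_nonneg zero_le_power) auto
      have "value_fn T p c Y U K s x w - value_fn T p c Y U K s x' w \<le> d + (x' + d + p * T) * ?q"
        using value_diff_le[OF x(1) d(1), of N] d(2) by simp
      also have "\<dots> \<le> d + C * ?q"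
        using q x d by (intro add_left_mono mult_right_mono) (auto simp: C_def)
      also have "\<dots> = D * d + C * F T ^ N"
        by (simp add: D_def algebra_simps)
      also have "D * d < \<epsilon> / 2"
        using close D by (simp add: d_def field_simps)
      also have "C * F T ^ N < \<epsilon> / 2"
        using N C by (simp add: field_simps)
      finally have "value_fn T p c Y U K s x w - value_fn T p c Y U K s x' w < \<epsilon>"
        by simp
      moreover have "0 \<le> value_fn T p c Y U K s x w - value_fn T p c Y U K s x' w"
        using value_diff_ge[of x' x w s] sw x by simp
      ultimately show ?thesis by simp
    qed
    fix s x x' w
    assume "0 \<le> w" "w \<le> s" "s \<le> T" "0 \<le> x" "0 \<le> x'" "x \<le> X" "x' \<le> X" "\<bar>x - x'\<bar> < \<epsilon> / (2 * D)"
    then show "\<bar>value_fn T p c Y U K s x w - value_fn T p c Y U K s x' w\<bar> < \<epsilon>"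
      using main[of w s x' x] main[of w s x x'] assms
      by (cases x x' rule: linorder_cases) (auto simp: abs_minus_commute)
  qed
qed

end

theorem proposition3p3:
  fixes M :: "'a measure"
    and T p c :: real
    and F f lam G :: "real \<Rightarrow> real"
    and Y U :: "nat \<Rightarrow> 'a \<Rightarrow> real"
    and K :: "real \<Rightarrow> real \<Rightarrow> 'a measure"
  assumes "sparre_andersen M T p c F f lam G Y U K"
  shows "let V = value_fn T p c Y U K in
         (\<forall>x1 x2 s w. x2 \<le> x1 \<and> 0 \<le> x2 \<and> 0 \<le> w \<and> w \<le> s \<and> s \<le> T \<longrightarrow>
            x1 - x2 \<le> V s x1 w - V s x2 w) \<and>
         (\<forall>\<DD>. compact \<DD> \<and> \<DD> \<subseteq> domain T \<longrightarrow>
            (\<forall>\<epsilon>>0. \<exists>\<delta>>0. \<forall>s x x' w.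
               (s, x, w) \<in> \<DD> \<and> (s, x', w) \<in> \<DD> \<and> \<bar>x - x'\<bar> < \<delta> \<longrightarrow>
               \<bar>V s x w - V s x' w\<bar> < \<epsilon>))"
  unfolding Let_def
proof (intro conjI allI impI)
  interpret sparre_andersen M T p c F f lam G Y U K by fact
  show "x1 - x2 \<le> value_fn T p c Y U K s x1 w - value_fn T p c Y U K s x2 w"
    if "x2 \<le> x1 \<and> 0 \<le> x2 \<and> 0 \<le> w \<and> w \<le> s \<and> s \<le> T" for x1 x2 s w
    using that by (intro value_diff_ge) auto
  fix \<DD> :: "(real \<times> real \<times> real) set" and \<epsilon> :: real
  assume \<DD>: "compact \<DD> \<and> \<DD> \<subseteq> domain T" and "0 < \<epsilon>"
  then have "bounded \<DD>"
    by (intro compact_imp_bounded) simp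
  then obtain X where X: "\<forall>z\<in>\<DD>. norm z \<le> X"
    by (auto simp: bounded_iff)
  have le_X: "x \<le> X" if "(s, x, w) \<in> \<DD>" for s x w
  proof -
    have "x \<le> norm x" by simp
    also have "norm x \<le> norm (x, w)" using norm_fst_le[of x w] by simp
    also have "\<dots> \<le> norm (s, x, w)" using norm_snd_le[of "(x, w)" s] by simp
    also have "\<dots> \<le> X" using X that by blast
    finally show ?thesis .
  qed
  obtain \<delta> where \<delta>: "0 < \<delta>" "\<And>s x x' w. 0 \<le> w \<Longrightarrow> w \<le> s \<Longrightarrow> s \<le> T \<Longrightarrow> 0 \<le> x \<Longrightarrow> 0 \<le> x' \<Longrightarrow>
    x \<le> X \<Longrightarrow> x' \<le> X \<Longrightarrow> \<bar>x - x'\<bar> < \<delta> \<Longrightarrow>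
    \<bar>value_fn T p c Y U K s x w - value_fn T p c Y U K s x' w\<bar> < \<epsilon>"
    by (rule value_uniformly_continuous[OF \<open>0 < \<epsilon>\<close>, of X]) blast
  show "\<exists>\<delta>>0. \<forall>s x x' w. (s, x, w) \<in> \<DD> \<and> (s, x', w) \<in> \<DD> \<and> \<bar>x - x'\<bar> < \<delta> \<longrightarrow>
      \<bar>value_fn T p c Y U K s x w - value_fn T p c Y U K s x' w\<bar> < \<epsilon>"
  proof (intro exI[of _ \<delta>] conjI allI impI \<delta>(1))
    fix s x x' w
    assume *: "(s, x, w) \<in> \<DD> \<and> (s, x', w) \<in> \<DD> \<and> \<bar>x - x'\<bar> < \<delta>"
    then have "(s, x, w) \<in> domain T" "(s, x', w) \<in> domain T" using \<DD> by auto
    with * show "\<bar>value_fn T p c Y U K s x w - value_fn T p c Y U K s x' w\<bar> < \<epsilon>"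
      by (intro \<delta>(2)) (auto simp: domain_def le_X)
  qed
qed

end
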